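(* A PBW basis for $\mathcal U^+_q$ is obtained by its alternating generators $$\lbrace \mathcal W_{-i} \rbrace_{i \in \mathbb N}, \qquad \lbrace \mathcal G_{j+1} \rbrace_{j\in \mathbb N}, \qquad \lbrace \mathcal {\tilde G}_{k+1} \rbrace_{k\in \mathbb N}, \qquad \lbrace \mathcal W_{\ell+1} \rbrace_{\ell\in \mathbb N}$$ in any linear order $<$ that satisfies $$\mathcal W_{-i} < \mathcal G_{j+1} < \mathcal{\tilde G}_{k+1} < \mathcal W_{\ell+1} \qquad \text{for all } i,j,k,\ell\in \mathbb N.$$
   Context: Let $\mathbb F$ be a field and fix a nonzero $q\in\mathbb F$ that is not a root of unity. $\mathbb N=\{0,1,2,\ldots\}$. All algebras are associative, over $\mathbb F$, with multiplicative identity. For elements $X,Y$ of an algebra, $[X,Y]=XY-YX$ and $[X,Y]_q=qXY-q^{-1}YX$. The algebra $\mathcal U^+_q$ is defined by generators (called alternating generators) $\mathcal W_{-k}, \mathcal W_{k+1}, \mathcal G_{k+1}, \mathcal{\tilde G}_{k+1}$ ($k\in\mathbb N$) and the following relations for all $k,\ell\in\mathbb N$: $[\mathcal W_0,\mathcal W_{k+1}]=[\mathcal W_{-k},\mathcal W_1]=(1-q^{-2})(\mathcal{\tilde G}_{k+1}-\mathcal G_{k+1})$; $[\mathcal W_0,\mathcal G_{k+1}]_q=[\mathcal{\tilde G}_{k+1},\mathcal W_0]_q=(q-q^{-1})\mathcal W_{-k-1}$; $[\mathcal G_{k+1},\mathcal W_1]_q=[\mathcal W_1,\mathcal{\tilde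 G}_{k+1}]_q=(q-q^{-1})\mathcal W_{k+2}$; $[\mathcal W_{-k},\mathcal W_{-\ell}]=0$; $[\mathcal W_{k+1},\mathcal W_{\ell+1}]=0$; $[\mathcal W_{-k},\mathcal W_{\ell+1}]+[\mathcal W_{k+1},\mathcal W_{-\ell}]=0$; $[\mathcal W_{-k},\mathcal G_{\ell+1}]+[\mathcal G_{k+1},\mathcal W_{-\ell}]=0$; $[\mathcal W_{-k},\mathcal{\tilde G}_{\ell+1}]+[\mathcal{\tilde G}_{k+1},\mathcal W_{-\ell}]=0$; $[\mathcal W_{k+1},\mathcal G_{\ell+1}]+[\mathcal G_{k+1},\mathcal W_{\ell+1}]=0$; $[\mathcal W_{k+1},\mathcal{\tilde G}_{\ell+1}]+[\mathcal{\tilde G}_{k+1},\mathcal W_{\ell+1}]=0$; $[\mathcal G_{k+1},\mathcal G_{\ell+1}]=0$; $[\mathcal{\tilde G}_{k+1},\mathcal{\tilde G}_{\ell+1}]=0$; $[\mathcal{\tilde G}_{k+1},\mathcal G_{\ell+1}]+[\mathcal G_{k+1},\mathcal{\tilde G}_{\ell+1}]=0$. A Poincaré-Birkhoff-Witt (PBW) basis for an algebra $\mathcal A$ consists of a subset $\Omega\subseteq\mathcal A$ and a linear order $<$ on $\Omega$ such that the following is a basis for the vector space $\mathcal A$: the products $a_1a_2\cdots a_n$ with $n\in\mathbb N$, $a_1,\ldots,a_n\in\Omega$, $a_1\le a_2\le\cdots\le a_n$. The empty product is interpreted as the multiplicative identity of $\mathcal A$. *)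

theory Defs
  imports "HOL-Algebra.QuotRing" "Jordan_Normal_Form.VS_Connect" "HOL-Library.Poly_Mapping"
begin

section \<open>Free associative algebras\<close>

text \<open>Words under concatenation form a monoid, written additively because that is what the
  convolution product of \<^typ>\<open>'a \<Rightarrow>\<^sub>0 'f\<close> expects. The free associative unital algebra over \<open>'f\<close>
  on the alphabet \<open>'g\<close> is then the monoid algebra \<open>'g list \<Rightarrow>\<^sub>0 'f\<close>.\<close>

instantiation list :: (type) monoid_add
begin

definition zero_list :: "'a list" where "0 = []"
definition plus_list :: "'a list \<Rightarrow> 'a list \<Rightarrow> 'a list" where "xs + ys = xs @ ys"

instance
  by standard (simp_all add: zero_list_def plus_list_def)

end

type_synonym ('g, 'f) free_algebra = "'g list \<Rightarrow>\<^sub>0 'f"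

definition letter :: "'g \<Rightarrow> ('g, 'f::field) free_algebra" where
  "letter g = Poly_Mapping.single [g] 1"

definition scalar :: "'f \<Rightarrow> ('g, 'f::field) free_algebra" where
  "scalar c = Poly_Mapping.single [] c"

definition commutator :: "'a::ring_1 \<Rightarrow> 'a \<Rightarrow> 'a" where
  "commutator X Y = X * Y - Y * X"

definition q_commutator ::
    "'f::field \<Rightarrow> ('g, 'f) free_algebra \<Rightarrow> ('g, 'f) free_algebra \<Rightarrow> ('g, 'f) free_algebra" where
  "q_commutator q X Y = scalar q * X * Y - scalar (inverse q) * Y * X"

section \<open>Algebras presented by generators and relations\<close>

definition relation_ideal ::
    "(('g, 'f::field) free_algebra \<Rightarrow> ('g, 'f) free_algebra \<Rightarrow> bool) \<Rightarrow> ('g, 'f) free_algebra set" where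
  "relation_ideal E = genideal class_ring {x - y | x y. E x y}"

text \<open>\<open>E x y\<close> is the defining relation \<open>x = y\<close>. Scalars act on the quotient through
  multiplication by the coset of a constant.\<close>

definition presented_algebra ::
    "(('g, 'f::field) free_algebra \<Rightarrow> ('g, 'f) free_algebra \<Rightarrow> bool)
      \<Rightarrow> ('f, ('g, 'f) free_algebra set) module" where
  "presented_algebra E =
    (let I = relation_ideal E; Q = class_ring Quot I in
      \<lparr>carrier = carrier Q, mult = mult Q, one = one Q, zero = zero Q, add = add Q,
       smult = (\<lambda>c X. (I +>\<^bsub>class_ring\<^esub> scalar c) \<otimes>\<^bsub>Q\<^esub> X)\<rparr>)"

definition presented_gen ::
    "(('g, 'f::field) free_algebra \<Rightarrow> ('g, 'f) free_algebra \<Rightarrow> bool)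
      \<Rightarrow> 'g \<Rightarrow> ('g, 'f) free_algebra set" where
  "presented_gen E g = relation_ideal E +>\<^bsub>class_ring\<^esub> letter g"

lemma scalar_simps:
  "scalar (a + b) = scalar a + scalar b" "scalar (a * b) = scalar a * scalar b" "scalar 1 = 1"
  by (simp_all add: scalar_def single_add mult_single flip: zero_list_def)

lemma scalar_commute: "scalar c * x = x * scalar c"
proof (induction x rule: update_induct)
  case const
  show ?case by simp
next
  case (update f a b)
  have "Poly_Mapping.update a b f = f + Poly_Mapping.single a b"
    using update(1) by (intro poly_mapping_eqI) (auto simp: lookup_update lookup_add lookup_single lookup_update when_def in_keys_iff update.rep_eq)
  then show ?case
    using update by (simp add: algebra_simps scalar_def mult_single plus_list_def)
qed

text \<open>The quotient is an associative unital algebra over the field \<open>'f\<close>; in particular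
  \<^const>\<open>vectorspace.basis\<close> below is used inside its locale.\<close>

lemma ring_presented_algebra: "ring (presented_algebra E)" (is "ring ?A")
  and vectorspace_presented_algebra: "vectorspace class_ring (presented_algebra E)"
  and smult_mult_presented_algebra:
    "x \<in> carrier (presented_algebra E) \<Longrightarrow> y \<in> carrier (presented_algebra E) \<Longrightarrow>
      (c \<odot>\<^bsub>presented_algebra E\<^esub> x) \<otimes>\<^bsub>presented_algebra E\<^esub> y
        = c \<odot>\<^bsub>presented_algebra E\<^esub> (x \<otimes>\<^bsub>presented_algebra E\<^esub> y) \<and>
      x \<otimes>\<^bsub>presented_algebra E\<^esub> (c \<odot>\<^bsub>presented_algebra E\<^esub> y)
        = c \<odot>\<^bsub>presented_algebra E\<^esub> (x \<otimes>\<^bsub>presented_algebra E\<^esub> y)"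
proof -
  define R :: "('a, 'b) free_algebra ring" where "R = class_ring"
  have R: "ring R" unfolding R_def by (rule class_ring.ring_axioms)
  interpret I: ideal "relation_ideal E" R
    using ring.genideal_ideal[OF R, of "{x - y | x y. E x y}"]
    by (simp add: R_def relation_ideal_def)
  define I where "I = relation_ideal E"
  define Q where "Q = R Quot I"
  interpret Q: ring Q unfolding Q_def I_def by (rule I.quotient_is_ring)
  interpret h: ring_hom_ring R Q "(+>\<^bsub>R\<^esub>) I"
    unfolding Q_def I_def by (rule I.rcos_ring_hom_ring)
  have A: "presented_algebra E = \<lparr>carrier = carrier Q, mult = mult Q, one = one Q, zero = zero Q,
      add = add Q, smult = (\<lambda>c X. (I +>\<^bsub>R\<^esub> scalar c) \<otimes>\<^bsub>Q\<^esub> X)\<rparr>"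
    by (simp add: presented_algebra_def Let_def Q_def I_def R_def)
  have RR: "ring ?A"
    unfolding A
    by (rule ringI; (rule abelian_groupI monoid.intro)?)
       (auto simp: Q.m_assoc Q.a_ac Q.l_distr Q.r_distr intro: Q.l_neg Q.a_inv_closed)
  then interpret A: ring ?A .
  show "ring ?A" by (rule RR)
  have s: "I +>\<^bsub>R\<^esub> scalar c \<in> carrier Q" for c
    by (rule h.hom_closed) (simp add: R_def)
  have sadd: "I +>\<^bsub>R\<^esub> scalar (a + b) = (I +>\<^bsub>R\<^esub> scalar a) \<oplus>\<^bsub>Q\<^esub> (I +>\<^bsub>R\<^esub> scalar b)" for a b
    by (subst h.hom_add [symmetric]) (simp_all add: R_def scalar_simps)
  have smul: "I +>\<^bsub>R\<^esub> scalar (a * b) = (I +>\<^bsub>R\<^esub> scalar a) \<otimes>\<^bsub>Q\<^esub> (I +>\<^bsub>R\<^esub> scalar b)" for a b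
    by (subst h.hom_mult [symmetric]) (simp_all add: R_def scalar_simps)
  have sone: "I +>\<^bsub>R\<^esub> scalar 1 = \<one>\<^bsub>Q\<^esub>"
    using h.hom_one by (simp add: R_def scalar_simps)
  have scom: "(I +>\<^bsub>R\<^esub> scalar c) \<otimes>\<^bsub>Q\<^esub> x = x \<otimes>\<^bsub>Q\<^esub> (I +>\<^bsub>R\<^esub> scalar c)" if x: "x \<in> carrier Q" for c x
  proof -
    obtain y where y: "x = I +>\<^bsub>R\<^esub> y"
      using x unfolding Q_def FactRing_def A_RCOSETS_def' by auto
    show ?thesis
      unfolding y by (subst (1 2) h.hom_mult [symmetric]) (simp_all add: R_def scalar_commute)
  qed
  have "field (class_ring :: 'b ring)"
    by (rule class_field)
  moreover from this have "cring (class_ring :: 'b ring)"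
    by (simp add: field_def domain_def)
  ultimately show "vectorspace class_ring ?A"
    unfolding vectorspace_def Module.module_def Module.module_axioms_def
    using A.abelian_group_axioms
    by (auto simp: A s sadd smul sone Q.l_distr Q.r_distr Q.m_assoc)
  show "(c \<odot>\<^bsub>?A\<^esub> x) \<otimes>\<^bsub>?A\<^esub> y = c \<odot>\<^bsub>?A\<^esub> (x \<otimes>\<^bsub>?A\<^esub> y) \<and> x \<otimes>\<^bsub>?A\<^esub> (c \<odot>\<^bsub>?A\<^esub> y) = c \<odot>\<^bsub>?A\<^esub> (x \<otimes>\<^bsub>?A\<^esub> y)"
    if "x \<in> carrier ?A" "y \<in> carrier ?A" for x y c
    using that s[of c] scom[of x c] by (auto simp: A simp flip: Q.m_assoc)
qed

section \<open>The algebra \<open>U\<^sub>q\<^sup>+\<close> in the alternating presentation\<close>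

text \<open>\<open>Wneg k\<close>, \<open>G k\<close>, \<open>Gt k\<close>, \<open>Wpos k\<close> stand for \<open>W\<close> with index \<open>-k\<close>, \<open>G\<close> with index \<open>k+1\<close>,
  \<open>G\<close> tilde with index \<open>k+1\<close>, and \<open>W\<close> with index \<open>k+1\<close>.\<close>

datatype alt_gen = Wneg nat | G nat | Gt nat | Wpos nat

abbreviation wn :: "nat \<Rightarrow> (alt_gen, 'f::field) free_algebra" where "wn k \<equiv> letter (Wneg k)"
abbreviation wp :: "nat \<Rightarrow> (alt_gen, 'f::field) free_algebra" where "wp k \<equiv> letter (Wpos k)"
abbreviation gg :: "nat \<Rightarrow> (alt_gen, 'f::field) free_algebra" where "gg k \<equiv> letter (G k)"
abbreviation gt :: "nat \<Rightarrow> (alt_gen, 'f::field) free_algebra" where "gt k \<equiv> letter (Gt k)"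

inductive alt_rel ::
    "'f::field \<Rightarrow> (alt_gen, 'f) free_algebra \<Rightarrow> (alt_gen, 'f) free_algebra \<Rightarrow> bool"
  for q :: 'f where
  "alt_rel q (commutator (wn 0) (wp k)) (scalar (1 - inverse (q\<^sup>2)) * (gt k - gg k))"
| "alt_rel q (commutator (wn k) (wp 0)) (scalar (1 - inverse (q\<^sup>2)) * (gt k - gg k))"
| "alt_rel q (q_commutator q (wn 0) (gg k)) (scalar (q - inverse q) * wn (k + 1))"
| "alt_rel q (q_commutator q (gt k) (wn 0)) (scalar (q - inverse q) * wn (k + 1))"
| "alt_rel q (q_commutator q (gg k) (wp 0)) (scalar (q - inverse q) * wp (k + 1))"
| "alt_rel q (q_commutator q (wp 0) (gt k)) (scalar (q - inverse q) * wp (k + 1))"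
| "alt_rel q (commutator (wn k) (wn l)) 0"
| "alt_rel q (commutator (wp k) (wp l)) 0"
| "alt_rel q (commutator (wn k) (wp l) + commutator (wp k) (wn l)) 0"
| "alt_rel q (commutator (wn k) (gg l) + commutator (gg k) (wn l)) 0"
| "alt_rel q (commutator (wn k) (gt l) + commutator (gt k) (wn l)) 0"
| "alt_rel q (commutator (wp k) (gg l) + commutator (gg k) (wp l)) 0"
| "alt_rel q (commutator (wp k) (gt l) + commutator (gt k) (wp l)) 0"
| "alt_rel q (commutator (gg k) (gg l)) 0"
| "alt_rel q (commutator (gt k) (gt l)) 0"
| "alt_rel q (commutator (gt k) (gg l) + commutator (gg k) (gt l)) 0"

definition Uq_plus :: "'f::field \<Rightarrow> ('f, (alt_gen, 'f) free_algebra set) module" where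
  "Uq_plus q = presented_algebra (alt_rel q)"

definition Uq_gen :: "'f::field \<Rightarrow> alt_gen \<Rightarrow> (alt_gen, 'f) free_algebra set" where
  "Uq_gen q = presented_gen (alt_rel q)"

section \<open>PBW bases\<close>

definition list_prod :: "('a, 'b) monoid_scheme \<Rightarrow> 'a list \<Rightarrow> 'a" where
  "list_prod A as = foldr (mult A) as (one A)"

text \<open>\<open>(a, b) \<in> r\<close> means \<open>a \<le> b\<close>. The basis is the family of ordered products, so
  different nondecreasing sequences are required to have different products.\<close>

definition PBW_basis ::
    "('f, 'k) ring_scheme \<Rightarrow> ('f, 'a, 'm) module_scheme \<Rightarrow> 'a set \<Rightarrow> 'a rel \<Rightarrow> bool" where
  "PBW_basis K A \<Omega> r \<longleftrightarrow>
    \<Omega> \<subseteq> carrier A \<and> linear_order_on \<Omega> r \<and>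
    (let S = {as. set as \<subseteq> \<Omega> \<and> sorted_wrt (\<lambda>a b. (a, b) \<in> r) as} in
      inj_on (list_prod A) S \<and> vectorspace.basis K A (list_prod A ` S))"

end

theory Submission
  imports Defs "HOL-Computational_Algebra.Formal_Power_Series" "HOL-Library.Function_Algebras"
begin

text \<open>Write \<open>A(t)\<close>, \<open>B(t)\<close>, \<open>C(t)\<close>, \<open>D(t)\<close> for the generating functions of the \<open>W\<close> with nonpositive index,
  of \<open>G\<close>, of \<open>G\<close> tilde and of the \<open>W\<close> with positive index, where \<open>B\<close> and \<open>C\<close> have constant term 1.

  Spanning: the defining relations imply quadratic exchange relations between these series. With the
  degrees \<open>2k + 1\<close> for \<open>A\<^sub>k\<close>, \<open>D\<^sub>k\<close> and \<open>2k\<close> for \<open>B\<^sub>k\<close>, \<open>C\<^sub>k\<close>, an exchange relation rewrites a product of two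
  generators in the wrong order as a multiple of the product in the right order plus products with
  the same total degree and a larger sum of squared degrees, so straightening terminates.

  Independence: the exchange relations have the form of a reflection algebra, and solutions can be
  dressed: the matrix with rows \<open>(B, A)\<close>, \<open>(t D, C)\<close> may be multiplied by a matrix that is linear in
  \<open>t\<close> and has entries in a quantum torus. Multiplying \<open>N\<close> such matrices represents the
  algebra by operators on functions on a lattice. For a suitable weight on the lattice,
  \<open>A\<^sub>i\<close>, \<open>B\<^sub>i\<close>, \<open>C\<^sub>i\<close>, \<open>D\<^sub>i\<close> with small \<open>i\<close> have leading monomials with linearly independent exponents, so
  different ordered monomials have different leading terms.\<close>

unbundle fps_syntax
no_notation vec_index (infixl "$" 100)

section \<open>Dressing of the exchange relations\<close>

text \<open>Unprimed letters are series at the point \<open>s\<close>, primed ones at \<open>t\<close>; \<open>Q\<close> is \<open>q\<^sup>2\<close> and \<open>Qi\<close> its inverse. The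
  other half of the relations arises by exchanging \<open>a\<close> with \<open>d\<close> and \<open>b\<close> with \<open>c\<close>.\<close>

definition half_exchange ::
    "'r::ring_1 \<Rightarrow> 'r \<Rightarrow> 'r \<Rightarrow> 'r \<Rightarrow> 'r \<Rightarrow> 'r \<Rightarrow> 'r \<Rightarrow> 'r \<Rightarrow> 'r \<Rightarrow> 'r \<Rightarrow> 'r \<Rightarrow> 'r \<Rightarrow> bool" where
  "half_exchange Q Qi s t a a' b b' c c' d d' \<longleftrightarrow>
    a * a' = a' * a \<and>
    b * b' = b' * b \<and>
    s * (a * b' - b' * a) = t * (a' * b - b * a') \<and>
    a * b' - Qi * (b' * a) = a' * b - Qi * (b * a') \<and>
    s * (a * c' - c' * a) = t * (a' * c - c * a') \<and>
    c' * a - Qi * (a * c') = c * a' - Qi * (a' * c) \<and>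
    a * d' - d' * a = a' * d - d * a' \<and>
    (s - t) * (a * d' - d' * a) = (1 - Qi) * (b' * c - b * c') \<and>
    c * b' - b' * c = c' * b - b * c' \<and>
    (s - t) * (c * b' - b' * c) = (Q - 1) * (s * t * (a * d' - a' * d))"

text \<open>The centrality assumptions are triangular, \<open>s\<close> before \<open>t\<close>
  before \<open>Q\<close> and so on, so that as rewrite rules from left to right they sort products
  without looping. Together with \<open>kx\<close>, \<open>ky\<close>, \<open>yx\<close> they put
  central elements first, then \<open>x\<close>, \<open>y\<close>, \<open>k\<close>,
  \<open>ki\<close>, then the letters.\<close>

locale exchange_step =
  fixes s t Q Qi \<beta> \<gamma> x y k ki a a' b b' c c' d d' :: "'r::ring_1"
  assumes cen_s: "\<And>z. z \<in> {t, Q, Qi, \<beta>, \<gamma>, x, y, k, ki, a, a', b, b', c, c', d, d'} \<Longrightarrow> z * s = s * z"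
    and cen_t: "\<And>z. z \<in> {Q, Qi, \<beta>, \<gamma>, x, y, k, ki, a, a', b, b', c, c', d, d'} \<Longrightarrow> z * t = t * z"
    and cen_Q: "\<And>z. z \<in> {\<beta>, \<gamma>, x, y, k, ki, a, a', b, b', c, c', d, d'} \<Longrightarrow> z * Q = Q * z"
    and cen_Qi: "\<And>z. z \<in> {\<beta>, \<gamma>, x, y, k, ki, a, a', b, b', c, c', d, d'} \<Longrightarrow> z * Qi = Qi * z"
    and cen_b: "\<And>z. z \<in> {\<gamma>, x, y, k, ki, a, a', b, b', c, c', d, d'} \<Longrightarrow> z * \<beta> = \<beta> * z"
    and cen_g: "\<And>z. z \<in> {x, y, k, ki, a, a', b, b', c, c', d, d'} \<Longrightarrow> z * \<gamma> = \<gamma> * z"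
    and com_x: "\<And>z. z \<in> {a, a', b, b', c, c', d, d'} \<Longrightarrow> z * x = x * z"
    and com_y: "\<And>z. z \<in> {a, a', b, b', c, c', d, d'} \<Longrightarrow> z * y = y * z"
    and com_k: "\<And>z. z \<in> {a, a', b, b', c, c', d, d'} \<Longrightarrow> z * k = k * z"
    and com_ki: "\<And>z. z \<in> {a, a', b, b', c, c', d, d'} \<Longrightarrow> z * ki = ki * z"
    and QQi: "Q * Qi = 1" "Qi * Q = 1" and kki: "k * ki = 1" "ki * k = 1"
    and kx: "k * x = Q * (x * k)" "ki * x = Qi * (x * ki)"
    and ky: "k * y = Qi * (y * k)" "ki * y = Q * (y * ki)"
    and yx: "y * x = x * y - (1 - Qi) * (\<gamma> * ki - \<beta> * k)"
begin

text \<open>With products nested to the right, a rule for two neighbours must also match in front of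
  a further factor; this lemma and the next supply that form.\<close>

lemma left_commute_rule: "z * w = w * z \<Longrightarrow> z * (w * v) = w * (z * v)" for z w v :: 'r
  by (metis mult.assoc)
lemma assoc_rule: "z * w = u \<Longrightarrow> z * (w * v) = u * v" for z w v u :: 'r
  by (metis mult.assoc)

lemmas norm_rules =
  cen_s cen_t cen_Q cen_Qi cen_b cen_g com_x com_y com_k com_ki
  cen_s[THEN left_commute_rule] cen_t[THEN left_commute_rule] cen_Q[THEN left_commute_rule] cen_Qi[THEN left_commute_rule]
  cen_b[THEN left_commute_rule] cen_g[THEN left_commute_rule] com_x[THEN left_commute_rule]
  com_y[THEN left_commute_rule] com_k[THEN left_commute_rule] com_ki[THEN left_commute_rule]
  QQi kki kx ky yx QQi[THEN assoc_rule] kki[THEN assoc_rule] kx[THEN assoc_rule] ky[THEN assoc_rule] yx[THEN assoc_rule]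

text \<open>The dressed series are the entries of the product of the site matrix with rows
  \<open>(1 + s \<beta> k, x)\<close>, \<open>(Q s y, 1 + s \<gamma> ki)\<close> and the matrix with rows \<open>(b, ki a)\<close>, \<open>(Q s k d, c)\<close>.\<close>

definition "dressed_a \<equiv> (ki + s * \<beta>) * a + x * c"
definition "dressed_a' \<equiv> (ki + t * \<beta>) * a' + x * c'"
definition "dressed_b \<equiv> (1 + s * \<beta> * k) * b + Q * s * (x * k) * d"
definition "dressed_b' \<equiv> (1 + t * \<beta> * k) * b' + Q * t * (x * k) * d'"
definition "dressed_c \<equiv> (1 + s * \<gamma> * ki) * c + Q * s * (y * ki) * a"
definition "dressed_c' \<equiv> (1 + t * \<gamma> * ki) * c' + Q * t * (y * ki) * a'"
definition "dressed_d \<equiv> (k + s * \<gamma>) * d + y * b"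
definition "dressed_d' \<equiv> (k + t * \<gamma>) * d' + y * b'"
lemmas dressed_defs = dressed_a_def dressed_a'_def dressed_b_def dressed_b'_def dressed_c_def dressed_c'_def dressed_d_def dressed_d'_def

section \<open>Defects of the exchange relations and their behaviour under dressing\<close>

definition "ab2 \<equiv> s * (a * b' - b' * a) - t * (a' * b - b * a')"
definition "ab3 \<equiv> a * b' - Qi * (b' * a) - (a' * b - Qi * (b * a'))"
definition "ac2 \<equiv> s * (a * c' - c' * a) - t * (a' * c - c * a')"
definition "ac3 \<equiv> c' * a - Qi * (a * c') - (c * a' - Qi * (a' * c))"
definition "dc2 \<equiv> s * (d * c' - c' * d) - t * (d' * c - c * d')"
definition "dc3 \<equiv> d * c' - Qi * (c' * d) - (d' * c - Qi * (c * d'))"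
definition "db2 \<equiv> s * (d * b' - b' * d) - t * (d' * b - b * d')"
definition "db3 \<equiv> b' * d - Qi * (d * b') - (b * d' - Qi * (d' * b))"
definition "ad4 \<equiv> a * d' - d' * a - (a' * d - d * a')"
definition "ad6 \<equiv> (s - t) * (a * d' - d' * a) - (1 - Qi) * (b' * c - b * c')"
definition "cb5 \<equiv> c * b' - b' * c - (c' * b - b * c')"
definition "cb7 \<equiv> (s - t) * (c * b' - b' * c) - (Q - 1) * (s * t * (a * d' - a' * d))"
lemmas defect_defs = ab2_def ab3_def ac2_def ac3_def dc2_def dc3_def db2_def db3_def ad4_def ad6_def cb5_def cb7_def

text \<open>This and the next nine identities use no exchange relation: both sides have the same
  normal form. They express each defect of the dressed letters by undressed defects with
  coefficients on the left. Both halves of the relations contribute, for instance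
  \<open>c * c' - c' * c\<close> here.\<close>

lemma dressed_AA: "dressed_a * dressed_a' - dressed_a' * dressed_a =
  (ki + s * \<beta>) * (ki + t * \<beta>) * (a * a' - a' * a) + x * x * (c * c' - c' * c)
    - x * ki * ac3 + \<beta> * x * ac2"
  unfolding dressed_defs defect_defs by (simp add: algebra_simps norm_rules)

lemma dressed_BB: "dressed_b * dressed_b' - dressed_b' * dressed_b =
  (1 + s * \<beta> * k) * (1 + t * \<beta> * k) * (b * b' - b' * b)
    + Q * Q * s * t * x * k * x * k * (d * d' - d' * d) + Q * x * k * db2 - Q * Q * s * t * \<beta> * x * k * k * db3"
  unfolding dressed_defs defect_defs by (simp add: algebra_simps norm_rules)

lemma dressed_AB3: "dressed_a * dressed_b' - Qi * (dressed_b' * dressed_a) - (dressed_a' * dressed_b - Qi * (dressed_b * dressed_a')) =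
  (ki + s * \<beta> + t * \<beta> + s * t * \<beta> * \<beta> * k) * ab3 + x * (s * ad4 + cb5 - ad6)
    + \<beta> * x * k * (s * cb5 - cb7 + s * t * ad4) + Q * x * x * k * dc2"
  unfolding dressed_defs defect_defs by (simp add: algebra_simps norm_rules)

lemma dressed_AB2: "s * (dressed_a * dressed_b' - dressed_b' * dressed_a) - t * (dressed_a' * dressed_b - dressed_b * dressed_a') =
  (ki + s * \<beta> + t * \<beta> + s * t * \<beta> * \<beta> * k) * ab2
    + x * (Q * s * t * ad4 + cb7 + t * cb5)
    + s * t * \<beta> * x * k * (Q * ad6 + Q * t * ad4 + cb5) + Q * Q * s * t * x * x * k * dc3"
  unfolding dressed_defs defect_defs by (simp add: algebra_simps norm_rules)

lemma dressed_AC2: "s * (dressed_a * dressed_c' - dressed_c' * dressed_a) - t * (dressed_a' * dressed_c - dressed_c * dressed_a') =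
  ki * ac2 + \<beta> * ((s + t) * ac2 + s * t * ac3) - s * t * \<gamma> * ki * ki * ac3
    + s * t * \<beta> * \<gamma> * ki * ac2
    + ((Q * Q + Q) * s * t * y * ki * ki + Q * s * t * (s + t) * \<beta> * y * ki) * (a * a' - a' * a)
    + ((s + t) * x + s * t * \<gamma> * (1 + Qi) * x * ki) * (c * c' - c' * c)
    - Q * s * t * x * y * ki * ac3"
  unfolding dressed_defs defect_defs by (simp add: algebra_simps norm_rules)

lemma dressed_AC3: "dressed_c' * dressed_a - Qi * (dressed_a * dressed_c') - (dressed_c * dressed_a' - Qi * (dressed_a' * dressed_c)) =
  ki * ac3 + s * t * \<beta> * \<gamma> * ki * ac3 - \<beta> * ac2
    + \<gamma> * ki * ki * ((s + t) * ac3 + ac2)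
    - (Q * (s + t) * y * ki * ki + (Q + 1) * s * t * \<beta> * y * ki) * (a * a' - a' * a)
    - ((1 + Qi) * x + Qi * (s + t) * \<gamma> * x * ki) * (c * c' - c' * c) - x * y * ki * ac2"
  unfolding dressed_defs defect_defs by (simp add: algebra_simps norm_rules)

lemma dressed_AD4: "dressed_a * dressed_d' - dressed_d' * dressed_a - (dressed_a' * dressed_d - dressed_d * dressed_a') =
  (1 + s * t * \<beta> * \<gamma>) * ad4 + \<gamma> * ki * (s * ad4 - ad6)
    + \<beta> * k * (t * ad4 + ad6) + Q * y * ki * ab3 + \<beta> * y * ab2 + Q * x * k * dc3
    + \<gamma> * x * dc2 + x * y * cb5"
  unfolding dressed_defs defect_defs by (simp add: algebra_simps norm_rules)

lemma dressed_AD6: "(s - t) * (dressed_a * dressed_d' - dressed_d' * dressed_a) - (1 - Qi) * (dressed_b' * dressed_c - dressed_b * dressed_c') =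
  (1 + s * t * \<beta> * \<gamma>) * ad6 + s * \<beta> * k * ad6 + t * \<gamma> * ki * ad6
    + Q * y * ki * (ab2 - t * ab3) + s * \<beta> * y * (ab2 - t * ab3) + x * k * (s * Q * dc3 - dc2)
    + t * \<gamma> * x * (Q * s * dc3 - dc2) + x * y * (cb7 + (Q - 1) * s * t * ad4)"
  unfolding dressed_defs defect_defs by (simp add: algebra_simps norm_rules)

lemma dressed_CB5: "dressed_c * dressed_b' - dressed_b' * dressed_c - (dressed_c' * dressed_b - dressed_b * dressed_c') =
  (1 + s * t * \<beta> * \<gamma>) * cb5 + \<beta> * k * (s * cb5 - cb7)
    + \<gamma> * ki * (t * cb5 + cb7) + Q * x * k * dc2 + s * t * Q * \<gamma> * x * dc3
    + Q * y * ki * ab2 + Q * s * t * \<beta> * y * ab3 + Q * s * t * x * y * ad4"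
  unfolding dressed_defs defect_defs by (simp add: algebra_simps norm_rules)

lemma dressed_CB7: "(s - t) * (dressed_c * dressed_b' - dressed_b' * dressed_c) - (Q - 1) * (s * t * (dressed_a * dressed_d' - dressed_a' * dressed_d)) =
  (1 + s * t * \<beta> * \<gamma>) * cb7 + t * \<beta> * k * cb7 + s * \<gamma> * ki * cb7
    + Q * t * x * k * (s * dc3 - dc2) + Q * s * t * \<gamma> * x * (s * dc3 - dc2)
    + Q * s * y * ki * (ab2 - Q * t * ab3) + s * t * \<beta> * y * (ab2 - Q * t * ab3)
    + s * t * x * y * (Q * ad6 - (Q - 1) * cb5)"
  unfolding dressed_defs defect_defs by (simp add: algebra_simps norm_rules)

theorem half_exchange_step:
  assumes h1: "half_exchange Q Qi s t a a' b b' c c' d d'" and h2: "half_exchange Q Qi s t d d' c c' b b' a a'"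
  shows "half_exchange Q Qi s t dressed_a dressed_a' dressed_b dressed_b' dressed_c dressed_c' dressed_d dressed_d'"
proof -
  \<comment> \<open>The commutators of \<open>c\<close> and of \<open>d\<close> and the defects
    \<open>dc2\<close>, \<open>dc3\<close>, \<open>db2\<close>, \<open>db3\<close> vanish by the
    second half, where \<open>d\<close> plays the role of \<open>a\<close>.\<close>
  have aux: "a * a' - a' * a = 0" "b * b' - b' * b = 0" "c * c' - c' * c = 0" "d * d' - d' * d = 0"
    and z: "ab2 = 0" "ab3 = 0" "ac2 = 0" "ac3 = 0" "dc2 = 0" "dc3 = 0" "db2 = 0" "db3 = 0"
      "ad4 = 0" "ad6 = 0" "cb5 = 0" "cb7 = 0"
    unfolding defect_defs using h1 h2 unfolding half_exchange_def by auto
  show ?thesis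
    unfolding half_exchange_def
    using dressed_AA dressed_BB dressed_AB2 dressed_AB3 dressed_AC2 dressed_AC3 dressed_AD4 dressed_AD6 dressed_CB5 dressed_CB7
    by (simp only: aux z mult_zero_right add_0_right diff_0_right right_minus_eq simp_thms)
qed

end

text \<open>In series over series, \<open>fps_X\<close> plays the role of \<open>s\<close> and \<open>tvar\<close> that of \<open>t\<close>, so \<open>outer f\<close> is \<open>f(s)\<close> and
  \<open>fps_const f\<close> is \<open>f(t)\<close>.\<close>

abbreviation const2 :: "'r::ring_1 \<Rightarrow> 'r fps fps" where "const2 z \<equiv> fps_const (fps_const z)"
definition outer :: "'r::ring_1 fps \<Rightarrow> 'r fps fps" where "outer f = Abs_fps (\<lambda>n. fps_const (f $ n))"
abbreviation tvar :: "'r::ring_1 fps fps" where "tvar \<equiv> fps_const fps_X"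

lemma outer_nth [simp]: "outer f $ n = fps_const (f $ n)" by (simp add: outer_def)
lemma outer_add: "outer (f + g) = outer f + outer g" by (simp add: fps_eq_iff)
lemma fps_const_sum: "fps_const (sum f A) = (\<Sum>i\<in>A. fps_const (f i))"
  by (induction A rule: infinite_finite_induct) (simp_all flip: fps_const_add)
lemma outer_mult: "outer (f * g) = outer f * outer g"
  by (simp add: fps_eq_iff[of "outer (f * g)"] fps_mult_nth fps_const_sum)
lemma outer_const: "outer (fps_const z) = const2 z" by (simp add: fps_eq_iff)
lemma outer_X: "outer fps_X = fps_X" by (simp add: fps_eq_iff fps_X_def)
lemma outer_0: "outer 0 = 0" by (simp add: fps_eq_iff)
lemma outer_1: "outer 1 = 1" by (simp add: fps_eq_iff)
lemmas outer_simps = outer_add outer_mult outer_const outer_X outer_1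
lemma inner_simps:
  fixes f g :: "'r::ring_1 fps"
  shows "fps_const (f + g) = fps_const f + fps_const g" "fps_const (f * g) = fps_const f * fps_const g"
    "fps_const 1 = 1"
  by simp_all

lemma const2_outer: "(\<And>n. f $ n * z = z * f $ n) \<Longrightarrow> outer f * const2 z = const2 z * outer f"
  by (simp add: fps_eq_iff)
lemma const2_inner: "(\<And>n. f $ n * z = z * f $ n) \<Longrightarrow> fps_const f * const2 z = const2 z * fps_const f"
  by (simp add: fps_eq_iff)
lemma tvar_comm: "z * tvar = tvar * z"
  by (simp add: fps_eq_iff flip: fps_mult_fps_X_commute)
lemma const2_comm: "w * z = z * w \<Longrightarrow> const2 w * const2 z = const2 z * const2 w"
  by simp

section \<open>Dressing of power series by one site\<close>

definition exchange :: "'r::ring_1 \<Rightarrow> 'r \<Rightarrow> 'r fps \<Rightarrow> 'r fps \<Rightarrow> 'r fps \<Rightarrow> 'r fps \<Rightarrow> bool" where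
  "exchange Q Qi a b c d \<longleftrightarrow>
     half_exchange (const2 Q) (const2 Qi) fps_X tvar (outer a) (fps_const a) (outer b) (fps_const b)
       (outer c) (fps_const c) (outer d) (fps_const d) \<and>
     half_exchange (const2 Q) (const2 Qi) fps_X tvar (outer d) (fps_const d) (outer c) (fps_const c)
       (outer b) (fps_const b) (outer a) (fps_const a)"

text \<open>Up to normalisation these are the relations of U_q(sl_2) for \<open>x\<close>,
  \<open>y\<close>, \<open>k\<close>, with central elements \<open>\<beta>\<close>,
  \<open>\<gamma>\<close> as coefficients in the commutator of \<open>x\<close> and
  \<open>y\<close>.\<close>

locale exchange_site =
  fixes Q Qi \<beta> \<gamma> x y k ki :: "'r::ring_1"
  assumes cen_Q: "\<And>z. z * Q = Q * z" and cen_Qi: "\<And>z. z * Qi = Qi * z"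
    and cen_b: "\<And>z. z \<in> {\<gamma>, x, y, k, ki} \<Longrightarrow> z * \<beta> = \<beta> * z"
    and cen_g: "\<And>z. z \<in> {\<beta>, x, y, k, ki} \<Longrightarrow> z * \<gamma> = \<gamma> * z"
    and QQi: "Q * Qi = 1" "Qi * Q = 1" and kki: "k * ki = 1" "ki * k = 1"
    and kx: "k * x = Q * (x * k)" "ki * x = Qi * (x * ki)"
    and ky: "k * y = Qi * (y * k)" "ki * y = Q * (y * ki)"
    and yx: "y * x = x * y - (1 - Qi) * (\<gamma> * ki - \<beta> * k)"
begin

text \<open>Combined with exchanging \<open>a\<close> with \<open>d\<close> and \<open>b\<close>
  with \<open>c\<close>, this symmetry maps the dressing formula for \<open>A\<close> to that for
  \<open>D\<close> and the one for \<open>B\<close> to that for \<open>C\<close>.\<close>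

lemma swap: "exchange_site Q Qi \<gamma> \<beta> y x ki k"
proof unfold_locales
  show "x * y = y * x - (1 - Qi) * (\<beta> * k - \<gamma> * ki)"
    unfolding yx by (simp add: algebra_simps)
qed (rule cen_Q cen_Qi cen_b cen_g QQi kki kx ky; blast)+

lemma half_exchange_tower:
  assumes "exchange Q Qi a b c d"
    and com: "\<And>f n z. f \<in> {a, b, c, d} \<Longrightarrow> z \<in> {\<beta>, \<gamma>, x, y, k, ki} \<Longrightarrow> f $ n * z = z * f $ n"
  defines "A \<equiv> (fps_const ki + fps_X * fps_const \<beta>) * a + fps_const x * c"
    and "B \<equiv> (1 + fps_X * fps_const \<beta> * fps_const k) * b + fps_const Q * fps_X * (fps_const x * fps_const k) * d"
    and "C \<equiv> (1 + fps_X * fps_const \<gamma> * fps_const ki) * c + fps_const Q * fps_X * (fps_const y * fps_const ki) * a"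
    and "D \<equiv> (fps_const k + fps_X * fps_const \<gamma>) * d + fps_const y * b"
  shows "half_exchange (const2 Q) (const2 Qi) fps_X tvar (outer A) (fps_const A) (outer B) (fps_const B)
       (outer C) (fps_const C) (outer D) (fps_const D)"
proof -
  \<comment> \<open>In series over series \<open>fps_X\<close> and \<open>tvar\<close> are central,
    and the site elements commute with \<open>outer f\<close> and \<open>fps_const f\<close> because
    they commute with every coefficient.\<close>
  interpret S: exchange_step fps_X tvar "const2 Q" "const2 Qi" "const2 \<beta>" "const2 \<gamma>" "const2 x" "const2 y" "const2 k" "const2 ki"
    "outer a" "fps_const a" "outer b" "fps_const b" "outer c" "fps_const c" "outer d" "fps_const d"
  proof (unfold_locales, goal_cases)
    case (1 z) show ?case by (rule fps_mult_fps_X_commute[symmetric])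
  next
    case (2 z) show ?case by (rule tvar_comm)
  next
    case (3 z) then show ?case by (auto simp del: fps_const_mult intro!: const2_outer const2_inner const2_comm cen_Q)
  next
    case (4 z) then show ?case by (auto simp del: fps_const_mult intro!: const2_outer const2_inner const2_comm cen_Qi)
  next
    case (5 z) then show ?case by (auto simp del: fps_const_mult simp: cen_b com intro!: const2_outer const2_inner const2_comm)
  next
    case (6 z) then show ?case by (auto simp del: fps_const_mult simp: cen_g com intro!: const2_outer const2_inner const2_comm)
  next
    case (7 z) then show ?case by (auto simp del: fps_const_mult intro!: const2_outer const2_inner const2_comm com)
  next
    case (8 z) then show ?case by (auto simp del: fps_const_mult intro!: const2_outer const2_inner const2_comm com)
  next
    case (9 z) then show ?case by (auto simp del: fps_const_mult intro!: const2_outer const2_inner const2_comm com)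
  next
    case (10 z) then show ?case by (auto simp del: fps_const_mult intro!: const2_outer const2_inner const2_comm com)
  qed (simp_all only: fps_const_mult fps_const_sub QQi kki kx ky yx flip: fps_const_1_eq_1)
  have "S.dressed_a = outer A" "S.dressed_a' = fps_const A" "S.dressed_b = outer B" "S.dressed_b' = fps_const B"
     "S.dressed_c = outer C" "S.dressed_c' = fps_const C" "S.dressed_d = outer D" "S.dressed_d' = fps_const D"
    unfolding S.dressed_defs A_def B_def C_def D_def outer_simps inner_simps by (rule refl)+
  then show ?thesis
    using S.half_exchange_step assms(1) unfolding exchange_def by simp
qed

text \<open>The second half is the first half for the swapped site applied to \<open>d\<close>,
  \<open>c\<close>, \<open>b\<close>, \<open>a\<close>.\<close>

theorem exchange_tower:
  assumes ex: "exchange Q Qi a b c d"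
    and com: "\<And>f n z. f \<in> {a, b, c, d} \<Longrightarrow> z \<in> {\<beta>, \<gamma>, x, y, k, ki} \<Longrightarrow> f $ n * z = z * f $ n"
  shows "exchange Q Qi ((fps_const ki + fps_X * fps_const \<beta>) * a + fps_const x * c)
    ((1 + fps_X * fps_const \<beta> * fps_const k) * b + fps_const Q * fps_X * (fps_const x * fps_const k) * d)
    ((1 + fps_X * fps_const \<gamma> * fps_const ki) * c + fps_const Q * fps_X * (fps_const y * fps_const ki) * a)
    ((fps_const k + fps_X * fps_const \<gamma>) * d + fps_const y * b)"
proof -
  interpret W: exchange_site Q Qi \<gamma> \<beta> y x ki k by (rule swap)
  have "exchange Q Qi d c b a" using ex by (simp add: exchange_def)
  from W.half_exchange_tower[OF this] half_exchange_tower[OF ex] com show ?thesis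
    unfolding exchange_def by blast
qed

end

section \<open>Operators on lattice functions\<close>

text \<open>A function on the lattice is read as the coefficients of a formal sum of monomials. Its
  support is unrestricted, so operators carry no support condition.\<close>

typedef (overloaded) ('e, 'f) lin_op =
  "{h :: ('e \<Rightarrow> 'f::field) \<Rightarrow> 'e \<Rightarrow> 'f.
     \<forall>a \<phi> b \<psi>. h (\<lambda>e. a * \<phi> e + b * \<psi> e) = (\<lambda>e. a * h \<phi> e + b * h \<psi> e)}"
  morphisms app Abs_lin_op
  by (rule exI[of _ id]) simp

setup_lifting type_definition_lin_op

instantiation lin_op :: (type, field) ring_1
begin
lift_definition zero_lin_op :: "('a, 'b) lin_op" is "\<lambda>_ _. 0" by simp
lift_definition one_lin_op :: "('a, 'b) lin_op" is "\<lambda>\<phi>. \<phi>" by simp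
lift_definition plus_lin_op :: "('a, 'b) lin_op \<Rightarrow> ('a, 'b) lin_op \<Rightarrow> ('a, 'b) lin_op"
  is "\<lambda>h g \<phi> e. h \<phi> e + g \<phi> e" by (simp add: algebra_simps)
lift_definition minus_lin_op :: "('a, 'b) lin_op \<Rightarrow> ('a, 'b) lin_op \<Rightarrow> ('a, 'b) lin_op"
  is "\<lambda>h g \<phi> e. h \<phi> e - g \<phi> e" by (simp add: algebra_simps)
lift_definition uminus_lin_op :: "('a, 'b) lin_op \<Rightarrow> ('a, 'b) lin_op"
  is "\<lambda>h \<phi> e. - h \<phi> e" by (simp add: algebra_simps)
lift_definition times_lin_op :: "('a, 'b) lin_op \<Rightarrow> ('a, 'b) lin_op \<Rightarrow> ('a, 'b) lin_op"
  is "\<lambda>h g \<phi>. h (g \<phi>)" by simp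
instance
proof
  fix a b c :: "('a, 'b) lin_op"
  have add: "h (\<lambda>e. \<phi> e + \<psi> e) = (\<lambda>e. h \<phi> e + h \<psi> e)"
    if "\<forall>a \<phi> b \<psi>. h (\<lambda>e. a * \<phi> e + b * \<psi> e) = (\<lambda>e. a * h \<phi> e + b * h \<psi> e)"
    for h :: "('a \<Rightarrow> 'b) \<Rightarrow> 'a \<Rightarrow> 'b" and \<phi> \<psi>
    using that[rule_format, of 1 \<phi> 1 \<psi>] by simp
  show "a * (b + c) = a * b + a * c"
    by transfer (simp add: add)
  show "(0::('a, 'b) lin_op) \<noteq> 1"
    by transfer (metis one_neq_zero)
qed (transfer; simp add: fun_eq_iff algebra_simps)+
end

text \<open>\<open>shift v\<close> is multiplication by the monomial with exponent \<open>v\<close>;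
  with diagonal operators that rescale monomials by powers of a parameter it gives a quantum
  torus.\<close>

lift_definition shift :: "'e::ab_group_add \<Rightarrow> ('e, 'f::field) lin_op" is "\<lambda>v \<phi> e. \<phi> (e - v)" by simp
lift_definition diag :: "('e \<Rightarrow> 'f) \<Rightarrow> ('e, 'f::field) lin_op" is "\<lambda>c \<phi> e. c e * \<phi> e"
  by (simp add: algebra_simps)

abbreviation scal :: "'f::field \<Rightarrow> ('e, 'f) lin_op" where "scal a \<equiv> diag (\<lambda>_. a)"

lemma app_simps: "app 0 \<phi> e = 0" "app 1 \<phi> e = \<phi> e" "app (X + Y) \<phi> e = app X \<phi> e + app Y \<phi> e"
  "app (X * Y) \<phi> = app X (app Y \<phi>)" "app (shift v) \<phi> e = \<phi> (e - v)" "app (diag c) \<phi> e = c e * \<phi> e"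
  for v :: "'e::ab_group_add"
  by (transfer; simp)+

lemma scal_central: "X * scal a = scal a * X"
proof transfer
  fix h :: "('a \<Rightarrow> 'b) \<Rightarrow> 'a \<Rightarrow> 'b" and a
  assume h: "\<forall>a \<phi> b \<psi>. h (\<lambda>e. a * \<phi> e + b * \<psi> e) = (\<lambda>e. a * h \<phi> e + b * h \<psi> e)"
  show "(\<lambda>\<phi>. h (\<lambda>e. a * \<phi> e)) = (\<lambda>\<phi> e. a * h \<phi> e)"
  proof
    fix \<phi> show "h (\<lambda>e. a * \<phi> e) = (\<lambda>e. a * h \<phi> e)"
      using h[rule_format, of a \<phi> 0 \<phi>] by simp
  qed
qed

text \<open>The lattice records the exponents of \<open>x\<close>, \<open>\<beta>\<close>, \<open>\<gamma>\<close> and of a further central variable \<open>\<zeta>\<close> at each site. The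
  relation between \<open>x\<close> and \<open>y\<close> makes \<open>x y - inverse Q \<beta> k - \<gamma> ki\<close> central; calling it \<open>\<zeta>\<close> gives \<open>y_op\<close>.\<close>

datatype var = VX nat | VB nat | VG nat | VZ nat
type_synonym expo = "var \<Rightarrow> int"

definition unit :: "var \<Rightarrow> expo" where "unit v = (\<lambda>w. if w = v then 1 else 0)"

lemma unit_simps: "unit v w = (if w = v then 1 else 0)" by (simp add: unit_def)

definition x_op :: "nat \<Rightarrow> (expo, 'f::field) lin_op" where "x_op n = shift (unit (VX n))"
definition b_op :: "nat \<Rightarrow> (expo, 'f::field) lin_op" where "b_op n = shift (unit (VB n))"
definition g_op :: "nat \<Rightarrow> (expo, 'f::field) lin_op" where "g_op n = shift (unit (VG n))"
definition k_op :: "'f \<Rightarrow> nat \<Rightarrow> (expo, 'f::field) lin_op" where "k_op Q n = diag (\<lambda>e. Q powi (e (VX n)))"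
definition ki_op :: "'f \<Rightarrow> nat \<Rightarrow> (expo, 'f::field) lin_op" where "ki_op Q n = diag (\<lambda>e. Q powi (- e (VX n)))"
definition y_op :: "'f \<Rightarrow> nat \<Rightarrow> (expo, 'f::field) lin_op" where
  "y_op Q n = shift (- unit (VX n)) * (shift (unit (VZ n)) + scal (inverse Q) * b_op n * k_op Q n + g_op n * ki_op Q n)"
lemmas op_defs = x_op_def b_op_def g_op_def k_op_def ki_op_def y_op_def

lemma op_eqI: "(\<And>\<phi> e. app X \<phi> e = app Y \<phi> e) \<Longrightarrow> X = Y"
  by (metis app_inject ext)

text \<open>Conjugation by \<open>x_op n\<close> scales \<open>k_op\<close> by \<open>Q\<close> and
  \<open>ki_op\<close> by its inverse. Passing from \<open>x y\<close> to \<open>y x\<close> thus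
  leaves the \<open>\<zeta>\<close> term fixed and rescales the other two terms, which yields the
  commutator.\<close>

lemma site_relations:
  fixes Q :: "'f::field" assumes "Q \<noteq> 0"
  shows "k_op Q n * ki_op Q n = 1" "ki_op Q n * k_op Q n = 1"
    "k_op Q n * x_op n = scal Q * (x_op n * k_op Q n)"
    "ki_op Q n * x_op n = scal (inverse Q) * (x_op n * ki_op Q n)"
    "k_op Q n * y_op Q n = scal (inverse Q) * (y_op Q n * k_op Q n)"
    "ki_op Q n * y_op Q n = scal Q * (y_op Q n * ki_op Q n)"
    "y_op Q n * x_op n = x_op n * y_op Q n - (1 - scal (inverse Q)) * (g_op n * ki_op Q n - b_op n * k_op Q n)"
    "scal Q * scal (inverse Q) = (1 :: (expo, 'f) lin_op)" "scal (inverse Q) * scal Q = (1 :: (expo, 'f) lin_op)"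
  using assms
  by (auto intro!: op_eqI simp: op_defs app_simps unit_simps power_int_add power_int_diff power_int_minus field_simps)

lemma site_commute:
  assumes "z \<in> {x_op n, y_op Q n, k_op Q n, ki_op Q n}"
  shows "z * b_op n = b_op n * z" "z * g_op n = g_op n * z" "b_op n * g_op n = g_op n * b_op n"
  using assms
  by (auto intro!: op_eqI simp: op_defs app_simps unit_simps algebra_simps)

definition site :: "'f \<Rightarrow> nat \<Rightarrow> (expo, 'f::field) lin_op set" where
  "site Q n = {b_op n, g_op n, x_op n, y_op Q n, k_op Q n, ki_op Q n}"

text \<open>Operators of different sites shift and read disjoint coordinates.\<close>

lemma sites_commute:
  assumes "n \<noteq> m" "z \<in> site Q n" "w \<in> site Q m"
  shows "z * w = w * z"
  using assms unfolding site_def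
  by (elim insertE emptyE) (auto intro!: op_eqI simp: op_defs app_simps unit_simps algebra_simps)

text \<open>The trivial solution \<open>A = D = 0\<close>, \<open>B = C = 1\<close>, dressed at the
  sites below \<open>n\<close>. The results are polynomials, so a tower of fixed height kills
  generators of large index; the height must be adapted to the words under study.\<close>

fun tA tB tC tD :: "'f \<Rightarrow> nat \<Rightarrow> (expo, 'f::field) lin_op fps" where
  "tA Q 0 = 0"
| "tA Q (Suc n) = (fps_const (ki_op Q n) + fps_X * fps_const (b_op n)) * tA Q n + fps_const (x_op n) * tC Q n"
| "tB Q 0 = 1"
| "tB Q (Suc n) = (1 + fps_X * fps_const (b_op n) * fps_const (k_op Q n)) * tB Q n
    + fps_const (scal Q) * fps_X * (fps_const (x_op n) * fps_const (k_op Q n)) * tD Q n"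
| "tC Q 0 = 1"
| "tC Q (Suc n) = (1 + fps_X * fps_const (g_op n) * fps_const (ki_op Q n)) * tC Q n
    + fps_const (scal Q) * fps_X * (fps_const (y_op Q n) * fps_const (ki_op Q n)) * tA Q n"
| "tD Q 0 = 0"
| "tD Q (Suc n) = (fps_const (k_op Q n) + fps_X * fps_const (g_op n)) * tD Q n + fps_const (y_op Q n) * tB Q n"

lemma tower_nth:
  "tA Q 0 $ i = 0" "tD Q 0 $ i = 0" "tB Q 0 $ i = (if i = 0 then 1 else 0)" "tC Q 0 $ i = (if i = 0 then 1 else 0)"
  "tA Q (Suc n) $ 0 = ki_op Q n * tA Q n $ 0 + x_op n * tC Q n $ 0"
  "tA Q (Suc n) $ Suc i = ki_op Q n * tA Q n $ Suc i + b_op n * tA Q n $ i + x_op n * tC Q n $ Suc i"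
  "tD Q (Suc n) $ 0 = k_op Q n * tD Q n $ 0 + y_op Q n * tB Q n $ 0"
  "tD Q (Suc n) $ Suc i = k_op Q n * tD Q n $ Suc i + g_op n * tD Q n $ i + y_op Q n * tB Q n $ Suc i"
  "tB Q (Suc n) $ 0 = tB Q n $ 0" "tC Q (Suc n) $ 0 = tC Q n $ 0"
  "tB Q (Suc n) $ Suc i = tB Q n $ Suc i + b_op n * k_op Q n * tB Q n $ i + scal Q * x_op n * k_op Q n * tD Q n $ i"
  "tC Q (Suc n) $ Suc i = tC Q n $ Suc i + g_op n * ki_op Q n * tC Q n $ i + scal Q * y_op Q n * ki_op Q n * tA Q n $ i"
  by (simp_all add: fps_mult_fps_X_commute [of "fps_const (scal Q)", symmetric] distrib_right distrib_left mult.assoc)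

text \<open>A tower of height \<open>n\<close> involves only the sites below \<open>n\<close>; its
  coefficients therefore commute with site \<open>n\<close>, as the next dressing requires.\<close>

lemma tower_commute:
  assumes "\<forall>j<n. \<forall>w\<in>site Q j. w * z = z * w"
  shows "tA Q n $ i * z = z * tA Q n $ i \<and> tB Q n $ i * z = z * tB Q n $ i \<and>
    tC Q n $ i * z = z * tC Q n $ i \<and> tD Q n $ i * z = z * tD Q n $ i"
  using assms
proof (induction n arbitrary: i)
  case 0
  show ?case by (simp add: tower_nth)
next
  case (Suc n)
  have mult: "u * v * z = z * (u * v)" if "u * z = z * u" "v * z = z * v" for u v
    using that by (metis mult.assoc)
  have add: "(u + v) * z = z * (u + v)" if "u * z = z * u" "v * z = z * v" for u v
    using that by (simp add: distrib_left distrib_right)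
  have s: "w * z = z * w" if "w \<in> site Q n" for w
    using Suc.prems[rule_format, of n w] that by simp
  have "b_op n * z = z * b_op n" "g_op n * z = z * g_op n" "x_op n * z = z * x_op n"
    "y_op Q n * z = z * y_op Q n" "k_op Q n * z = z * k_op Q n" "ki_op Q n * z = z * ki_op Q n"
    by (rule s; simp add: site_def)+
  note rules = this add mult scal_central [symmetric]
  have pre: "\<forall>j<n. \<forall>w\<in>site Q j. w * z = z * w"
    using Suc.prems less_SucI by blast
  have IH: "tA Q n $ i * z = z * tA Q n $ i" "tB Q n $ i * z = z * tB Q n $ i"
    "tC Q n $ i * z = z * tC Q n $ i" "tD Q n $ i * z = z * tD Q n $ i" for i
    using Suc.IH[OF pre, of i] by blast+
  show ?case
    by (cases i; simp only: tower_nth; intro conjI IH rules)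
qed

lemma exchange_site_ops:
  assumes "Q \<noteq> 0"
  shows "exchange_site (scal Q) (scal (inverse Q)) (b_op n) (g_op n) (x_op n) (y_op Q n) (k_op Q n) (ki_op Q n)"
proof (unfold_locales, goal_cases)
  case (3 z) then show ?case using site_commute(1)[of z n Q] site_commute(3)[of _ n Q, symmetric] by blast
next
  case (4 z) then show ?case using site_commute(2)[of z n Q] site_commute(3)[of _ n Q] by blast
qed (rule scal_central site_relations assms)+

theorem exchange_tower_ops:
  assumes "Q \<noteq> 0"
  shows "exchange (scal Q) (scal (inverse Q)) (tA Q n) (tB Q n) (tC Q n) (tD Q n)"
proof (induction n)
  case 0
  show ?case by (simp add: exchange_def half_exchange_def outer_simps outer_0)
next
  case (Suc n)
  interpret exchange_site "scal Q" "scal (inverse Q)" "b_op n" "g_op n" "x_op n" "y_op Q n" "k_op Q n" "ki_op Q n"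
    using assms by (rule exchange_site_ops)
  have "f $ i * z = z * f $ i" if "f \<in> {tA Q n, tB Q n, tC Q n, tD Q n}"
    "z \<in> {b_op n, g_op n, x_op n, y_op Q n, k_op Q n, ki_op Q n}" for f i z
  proof -
    have "\<forall>j<n. \<forall>w\<in>site Q j. w * z = z * w"
    proof (intro allI impI ballI)
      fix j w assume "j < n" "w \<in> site Q j"
      then show "w * z = z * w" using that(2) by (intro sites_commute[of j n]) (simp_all add: site_def)
    qed
    from tower_commute[OF this] that(1) show ?thesis by blast
  qed
  from exchange_tower[OF Suc.IH this] show ?case by simp
qed

section \<open>Leading exponents\<close>

text \<open>At a site \<open>x\<close> and \<open>y\<close> get weight 2, below the weight 3 of \<open>\<beta>\<close> and \<open>\<gamma>\<close>; the powers of 4 let the site added last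
  dominate.\<close>

definition weight :: "nat \<Rightarrow> expo \<Rightarrow> int" where
  "weight N e = (\<Sum>j<N. 4 ^ j * (2 * e (VX j) + 3 * e (VB j) + 3 * e (VG j) + 4 * e (VZ j)))"

lemma weight_add: "weight N (e + f) = weight N e + weight N f"
  and weight_diff: "weight N (e - f) = weight N e - weight N f"
  and weight_minus: "weight N (- e) = - weight N e"
  and weight_0 [simp]: "weight N 0 = 0"
  by (simp_all add: weight_def sum.distrib sum_subtractf sum_negf algebra_simps)

lemma weight_unit: "j < N \<Longrightarrow> weight N (unit (VX j)) = 2 * 4 ^ j" "j < N \<Longrightarrow> weight N (unit (VB j)) = 3 * 4 ^ j"
  "j < N \<Longrightarrow> weight N (unit (VG j)) = 3 * 4 ^ j" "j < N \<Longrightarrow> weight N (unit (VZ j)) = 4 * 4 ^ j"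
proof -
  have *: "(\<Sum>i<N. f i) = c * 4 ^ j" if "\<And>i. f i = (if i = j then c * 4 ^ i else 0)" "j < N" for f and c :: int
    using that by simp
  show "j < N \<Longrightarrow> weight N (unit (VX j)) = 2 * 4 ^ j" "j < N \<Longrightarrow> weight N (unit (VB j)) = 3 * 4 ^ j"
    "j < N \<Longrightarrow> weight N (unit (VG j)) = 3 * 4 ^ j" "j < N \<Longrightarrow> weight N (unit (VZ j)) = 4 * 4 ^ j"
    unfolding weight_def unit_simps by (rule *; simp)+
qed

section \<open>Filtration by weight and leading exponents of operators\<close>

definition low :: "nat \<Rightarrow> (expo, 'f::field) lin_op \<Rightarrow> int \<Rightarrow> bool" where
  "low N X m \<longleftrightarrow> (\<forall>\<phi> n. (\<forall>f. \<phi> f \<noteq> 0 \<longrightarrow> weight N f \<le> n) \<longrightarrow> (\<forall>f. app X \<phi> f \<noteq> 0 \<longrightarrow> weight N f \<le> n + m))"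

text \<open>Strictness away from \<open>e\<close> matters, since different exponents can have equal
  weight.\<close>

definition top_at :: "nat \<Rightarrow> (expo \<Rightarrow> 'f::field) \<Rightarrow> expo \<Rightarrow> bool" where
  "top_at N \<phi> e \<longleftrightarrow> \<phi> e \<noteq> 0 \<and> (\<forall>f. \<phi> f \<noteq> 0 \<longrightarrow> f = e \<or> weight N f < weight N e)"

text \<open>Only the shift of the top exponent is recorded. Its coefficient may depend on
  \<open>e\<close> through diagonal operators; that it stays nonzero is enough for leading exponents
  to add up in products.\<close>

definition lead :: "nat \<Rightarrow> (expo, 'f::field) lin_op \<Rightarrow> expo \<Rightarrow> bool" where
  "lead N X d \<longleftrightarrow> (\<forall>\<phi> e. top_at N \<phi> e \<longrightarrow> top_at N (app X \<phi>) (e + d))"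

lemma low_mono: "low N X m \<Longrightarrow> m \<le> m' \<Longrightarrow> low N X m'"
  unfolding low_def by (meson add_left_mono order_trans)

lemma low_add: "low N X m \<Longrightarrow> low N Y m \<Longrightarrow> low N (X + Y) m"
  unfolding low_def app_simps by (metis add_0)

lemma low_mult:
  fixes X Y :: "(expo, 'f::field) lin_op"
  shows "low N X m \<Longrightarrow> low N Y n \<Longrightarrow> low N (X * Y) (m + n)"
proof -
  assume X: "low N X m" and Y: "low N Y n"
  show ?thesis
    unfolding low_def app_simps
  proof (intro allI impI)
    fix \<phi> :: "expo \<Rightarrow> 'f" and l f assume "\<forall>f. \<phi> f \<noteq> 0 \<longrightarrow> weight N f \<le> l" "app X (app Y \<phi>) f \<noteq> 0"
    with Y have "\<forall>f. app Y \<phi> f \<noteq> 0 \<longrightarrow> weight N f \<le> l + n" unfolding low_def by blast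
    with X \<open>app X (app Y \<phi>) f \<noteq> 0\<close> have "weight N f \<le> l + n + m" unfolding low_def by blast
    then show "weight N f \<le> l + (m + n)" by simp
  qed
qed

lemma low_diag: "low N (diag c) 0"
  by (simp add: low_def app_simps)

lemma low_shift: "low N (shift v) (weight N v)"
  unfolding low_def app_simps
proof (intro allI impI)
  fix \<phi> n f assume "\<forall>f. \<phi> f \<noteq> 0 \<longrightarrow> weight N f \<le> n" "\<phi> (f - v) \<noteq> (0::'a)"
  then have "weight N (f - v) \<le> n" by blast
  then show "weight N f \<le> n + weight N v" by (simp add: weight_diff)
qed

lemma low_0: "low N 0 m" by (simp add: low_def app_simps)
lemma low_1: "low N 1 0" by (simp add: low_def app_simps)

lemma lead_mult:
  fixes X Y :: "(expo, 'f::field) lin_op"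
  shows "lead N X d \<Longrightarrow> lead N Y e \<Longrightarrow> lead N (X * Y) (d + e)"
proof -
  assume X: "lead N X d" and Y: "lead N Y e"
  show ?thesis
    unfolding lead_def app_simps
  proof (intro allI impI)
    fix \<phi> :: "expo \<Rightarrow> 'f" and f assume "top_at N \<phi> f"
    then have "top_at N (app X (app Y \<phi>)) ((f + e) + d)" using X Y unfolding lead_def by blast
    then show "top_at N (app X (app Y \<phi>)) (f + (d + e))" by (simp add: add.commute add.left_commute)
  qed
qed

lemma lead_1: "lead N 1 0"
  by (simp add: lead_def top_at_def app_simps)

lemma lead_diag: "(\<And>e. c e \<noteq> 0) \<Longrightarrow> lead N (diag c) 0"
  by (simp add: lead_def top_at_def app_simps)

lemma lead_shift: "lead N (shift v) v"
  unfolding lead_def top_at_def app_simps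
proof (intro allI impI conjI)
  fix \<phi> e assume h: "\<phi> e \<noteq> (0::'a) \<and> (\<forall>f. \<phi> f \<noteq> 0 \<longrightarrow> f = e \<or> weight N f < weight N e)"
  then show "\<phi> (e + v - v) \<noteq> 0" by simp
  fix f assume "\<phi> (f - v) \<noteq> 0"
  with h have "f - v = e \<or> weight N (f - v) < weight N e" by blast
  then show "f = e + v \<or> weight N f < weight N (e + v)" by (auto simp: weight_diff weight_add)
qed

text \<open>The second summand is supported strictly below the weight of \<open>e + d\<close>, so it
  neither cancels the top nor rivals it.\<close>

lemma lead_add:
  fixes X Y :: "(expo, 'f::field) lin_op"
  assumes X: "lead N X d" and Y: "low N Y m" and "m < weight N d"
  shows "lead N (X + Y) d"
  unfolding lead_def
proof (intro allI impI)
  fix \<phi> :: "expo \<Rightarrow> 'f" and e assume top: "top_at N \<phi> e"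
  then have "\<forall>f. \<phi> f \<noteq> 0 \<longrightarrow> weight N f \<le> weight N e"
    unfolding top_at_def by auto
  with Y have "app Y \<phi> f \<noteq> 0 \<Longrightarrow> weight N f \<le> weight N e + m" for f
    unfolding low_def by blast
  then have Y': "app Y \<phi> f \<noteq> 0 \<Longrightarrow> weight N f < weight N (e + d)" for f
    using assms(3) unfolding weight_add by fastforce
  have X': "top_at N (app X \<phi>) (e + d)"
    using X top unfolding lead_def by blast
  show "top_at N (app (X + Y) \<phi>) (e + d)"
    unfolding top_at_def app_simps
  proof (intro conjI allI impI)
    show "app X \<phi> (e + d) + app Y \<phi> (e + d) \<noteq> 0"
      using X' Y'[of "e + d"] unfolding top_at_def by (cases "app Y \<phi> (e + d) = 0") simp_all
    fix f assume "app X \<phi> f + app Y \<phi> f \<noteq> 0"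
    then have "app X \<phi> f \<noteq> 0 \<or> app Y \<phi> f \<noteq> 0" by auto
    then show "f = e + d \<or> weight N f < weight N (e + d)"
      using X' Y' unfolding top_at_def by blast
  qed
qed


lemma low_site:
  fixes Q :: "'a::field"
  assumes "n < N"
  shows "low N (x_op n :: (expo, 'a) lin_op) (2 * 4 ^ n)" "low N (b_op n :: (expo, 'a) lin_op) (3 * 4 ^ n)" "low N (g_op n :: (expo, 'a) lin_op) (3 * 4 ^ n)"
    "low N (k_op Q n) 0" "low N (ki_op Q n) 0" "low N (y_op Q n) (2 * 4 ^ n)"
proof -
  show *: "low N (x_op n :: (expo, 'a) lin_op) (2 * 4 ^ n)" "low N (b_op n :: (expo, 'a) lin_op) (3 * 4 ^ n)" "low N (g_op n :: (expo, 'a) lin_op) (3 * 4 ^ n)"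
    "low N (k_op Q n) 0" "low N (ki_op Q n) 0"
    using low_shift[of N "unit (VX n)"] low_shift[of N "unit (VB n)"] low_shift[of N "unit (VG n)"]
    by (simp_all add: op_defs weight_unit assms low_diag)
  have "low N (shift (unit (VZ n)) + scal (inverse Q) * b_op n * k_op Q n + g_op n * ki_op Q n) (4 * 4 ^ n)"
  proof (intro low_add)
    show "low N (shift (unit (VZ n)) :: (expo, 'a) lin_op) (4 * 4 ^ n)"
      using low_shift[of N "unit (VZ n)"] by (simp add: weight_unit assms)
    show "low N (scal (inverse Q) * b_op n * k_op Q n) (4 * 4 ^ n)"
      by (rule low_mono[OF low_mult[OF low_mult[OF low_diag *(2)] *(4)]]) simp
    show "low N (g_op n * ki_op Q n) (4 * 4 ^ n)"
      by (rule low_mono[OF low_mult[OF *(3) *(5)]]) simp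
  qed
  from low_mult[OF low_shift[of N "- unit (VX n)"] this] show "low N (y_op Q n) (2 * 4 ^ n)"
    unfolding y_op_def by (simp add: weight_minus weight_unit assms)
qed

lemma lead_site:
  assumes "n < N" "Q \<noteq> 0"
  shows "lead N (x_op n) (unit (VX n))" "lead N (b_op n) (unit (VB n))" "lead N (g_op n) (unit (VG n))"
    "lead N (k_op Q n) 0" "lead N (ki_op Q n) 0" "lead N (y_op Q n) (unit (VZ n) - unit (VX n))"
proof -
  show *: "lead N (x_op n) (unit (VX n))" "lead N (b_op n) (unit (VB n))" "lead N (g_op n) (unit (VG n))"
    "lead N (k_op Q n) 0" "lead N (ki_op Q n) 0"
    using assms by (simp_all add: op_defs lead_shift lead_diag)
  \<comment> \<open>The \<open>\<zeta>\<close> term has weight \<open>4 * 4 ^ n\<close> against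
    \<open>3 * 4 ^ n\<close> for the terms with \<open>\<beta>\<close> and \<open>\<gamma>\<close>,
    so it leads.\<close>
  have "lead N (shift (unit (VZ n)) + (scal (inverse Q) * b_op n * k_op Q n + g_op n * ki_op Q n)) (unit (VZ n))"
  proof (rule lead_add[OF lead_shift])
    show "low N (scal (inverse Q) * b_op n * k_op Q n + g_op n * ki_op Q n) (3 * 4 ^ n)"
    proof (intro low_add)
      show "low N (scal (inverse Q) * b_op n * k_op Q n) (3 * 4 ^ n)"
        by (rule low_mono[OF low_mult[OF low_mult[OF low_diag low_site(2)[OF assms(1)]] low_site(4)[OF assms(1)]]]) simp
      show "low N (g_op n * ki_op Q n) (3 * 4 ^ n)"
        by (rule low_mono[OF low_mult[OF low_site(3)[OF assms(1)] low_site(5)[OF assms(1)]]]) simp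
    qed
  qed (use assms in \<open>simp add: weight_unit\<close>)
  from lead_mult[OF lead_shift this, of "- unit (VX n)"] show "lead N (y_op Q n) (unit (VZ n) - unit (VX n))"
    unfolding y_op_def by (simp add: add.assoc)
qed

section \<open>Leading terms of the dressed series\<close>

lemma neg_one_less: "- 1 < (4::int) ^ n" "- 1 < 3 * (4::int) ^ n"
  using zero_less_power[of "4::int" n] by linarith+

text \<open>Site \<open>n\<close> adds at most \<open>3 * 4 ^ n\<close>, and
  \<open>3 * 4 ^ n + (4 ^ n - 1) = 4 ^ Suc n - 1\<close>.\<close>

lemma low_tower:
  assumes "n \<le> N"
  shows "low N (tA Q n $ i) (4 ^ n - 1) \<and> low N (tB Q n $ i) (4 ^ n - 1) \<and>
    low N (tC Q n $ i) (4 ^ n - 1) \<and> low N (tD Q n $ i) (4 ^ n - 1)"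
  using assms
proof (induction n arbitrary: i)
  case 0
  show ?case by (simp add: tower_nth low_0 low_1)
next
  case (Suc n)
  then have IH: "low N (tA Q n $ i) (4 ^ n - 1)" "low N (tB Q n $ i) (4 ^ n - 1)"
    "low N (tC Q n $ i) (4 ^ n - 1)" "low N (tD Q n $ i) (4 ^ n - 1)" for i
    by simp_all
  have "n < N" using Suc.prems by simp
  note site = low_site[OF this] low_diag
  show ?case
    by (cases i; simp only: tower_nth; intro conjI low_add;
        (rule low_mono, (rule IH low_mult site)+, simp add: neg_one_less))
qed

text \<open>The exponent of the product of the variables \<open>V j\<close> over the last
  \<open>i\<close> of \<open>n\<close> sites, which are the heaviest ones.\<close>

definition ramp :: "(nat \<Rightarrow> var) \<Rightarrow> nat \<Rightarrow> nat \<Rightarrow> expo" where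
  "ramp V n i = (\<Sum>j\<in>{n - i..<n}. unit (V j))"

lemma ramp_0 [simp]: "ramp V n 0 = 0" by (simp add: ramp_def)
lemma ramp_Suc: "i \<le> n \<Longrightarrow> ramp V (Suc n) (Suc i) = unit (V n) + ramp V n i"
  by (simp add: ramp_def atLeastLessThanSuc add.commute)

lemma weight_ramp_nonneg:
  assumes "V = VB \<or> V = VG" "n \<le> N"
  shows "weight N (ramp V n i) \<ge> 0"
proof -
  have "weight N (\<Sum>j\<in>J. unit (V j)) \<ge> 0" if "J \<subseteq> {..<N}" for J
    using finite_subset[OF that] that assms(1)
    by (induction J rule: finite_induct) (auto simp: weight_add weight_unit)
  from this[of "{n - i..<n}"] assms(2) show ?thesis unfolding ramp_def by force
qed

text \<open>The heaviest way to collect the \<open>i\<close>-th power of the variable is to take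
  \<open>\<beta>\<close> (or \<open>\<gamma>\<close>) at each of the last \<open>i\<close> sites.
  For \<open>tA\<close> and \<open>tD\<close> the factor \<open>x\<close> or \<open>y\<close> that
  is still required then comes from the next site below, \<open>n - 1 - i\<close>.\<close>

lemma lead_tower:
  fixes Q :: "'f::field"
  assumes "n \<le> N" "Q \<noteq> 0"
  shows "(i < n \<longrightarrow> lead N (tA Q n $ i) (ramp VB n i + unit (VX (n - 1 - i)))) \<and>
    (i \<le> n \<longrightarrow> lead N (tB Q n $ i) (ramp VB n i)) \<and>
    (i \<le> n \<longrightarrow> lead N (tC Q n $ i) (ramp VG n i)) \<and>
    (i < n \<longrightarrow> lead N (tD Q n $ i) (ramp VG n i + (unit (VZ (n - 1 - i)) - unit (VX (n - 1 - i)))))"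
  using assms(1)
proof (induction n arbitrary: i)
  case 0
  show ?case by (simp add: tower_nth lead_1 [unfolded zero_fun_def])
next
  case (Suc n)
  then have n: "n < N" "n \<le> N" by simp_all
  have IH: "i < n \<Longrightarrow> lead N (tA Q n $ i) (ramp VB n i + unit (VX (n - 1 - i)))"
    "i \<le> n \<Longrightarrow> lead N (tB Q n $ i) (ramp VB n i)" "i \<le> n \<Longrightarrow> lead N (tC Q n $ i) (ramp VG n i)"
    "i < n \<Longrightarrow> lead N (tD Q n $ i) (ramp VG n i + (unit (VZ (n - 1 - i)) - unit (VX (n - 1 - i))))" for i
    using Suc.IH[OF n(2), of i] by blast+
  have low: "low N (tA Q n $ i) (4 ^ n - 1)" "low N (tB Q n $ i) (4 ^ n - 1)"
    "low N (tC Q n $ i) (4 ^ n - 1)" "low N (tD Q n $ i) (4 ^ n - 1)" for i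
    using low_tower[OF n(2)] by blast+
  have p: "(1 :: int) \<le> 4 ^ n" by simp
  note site = low_site[OF n(1)] low_diag
  note lsite = lead_site[OF n(1) assms(2)]
  have nonneg: "weight N (ramp VB n i) \<ge> 0" "weight N (ramp VG n i) \<ge> 0" for i
    by (rule weight_ramp_nonneg; simp add: n)+
  have pos: "j < n \<Longrightarrow> weight N (unit (VX j)) \<ge> 0" "j < n \<Longrightarrow> weight N (unit (VZ j) - unit (VX j)) \<ge> 0" for j
    using n by (simp_all add: weight_diff weight_unit)
  \<comment> \<open>In each recursion the middle term, with \<open>\<beta>\<close> or
    \<open>\<gamma>\<close> at the new site, has weight at least \<open>3 * 4 ^ n\<close>; the
    others reach at most \<open>2 * 4 ^ n + (4 ^ n - 1)\<close>.\<close>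
  have main: "lead N (X + L * Y + Z) (d + e)"
    if "lead N L d" "lead N Y e" "low N X (4 ^ n - 1)" "low N Z (3 * 4 ^ n - 1)"
      "weight N d \<ge> 3 * 4 ^ n" "weight N e \<ge> 0" for L X Y Z :: "(expo, 'f) lin_op" and d e
  proof -
    have "low N (X + Z) (3 * 4 ^ n - 1)"
      by (rule low_add[OF low_mono[OF that(3)] that(4)]) (use p in linarith)
    then have "lead N (L * Y + (X + Z)) (d + e)"
      using that by (intro lead_add[OF lead_mult]) (auto simp: weight_add)
    then show ?thesis by (simp add: algebra_simps)
  qed
  have low2: "low N (x_op n * tC Q n $ i) (3 * 4 ^ n - 1)" "low N (y_op Q n * tB Q n $ i) (3 * 4 ^ n - 1)"
    "low N (scal Q * x_op n * k_op Q n * tD Q n $ i) (3 * 4 ^ n - 1)"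
    "low N (scal Q * y_op Q n * ki_op Q n * tA Q n $ i) (3 * 4 ^ n - 1)" for i
    by (rule low_mono, (rule low low_mult site)+, use p in linarith)+
  have low1: "low N (ki_op Q n * tA Q n $ i) (4 ^ n - 1)" "low N (k_op Q n * tD Q n $ i) (4 ^ n - 1)" for i
    by (rule low_mono, (rule low low_mult site)+, use p in linarith)+
  have leadk: "lead N (b_op n * k_op Q n) (unit (VB n))" "lead N (g_op n * ki_op Q n) (unit (VG n))"
    using lead_mult[OF lsite(2,4)] lead_mult[OF lsite(3,5)] by simp_all
  show ?case
  proof (cases i)
    case 0
    \<comment> \<open>In degree 0 no \<open>\<beta>\<close> or \<open>\<gamma>\<close> is available;
      \<open>x\<close> or \<open>y\<close> at the new site leads with weight
      \<open>2 * 4 ^ n\<close>.\<close>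
    have A: "lead N (x_op n * tC Q n $ 0 + ki_op Q n * tA Q n $ 0) (unit (VX n) + 0)"
      by (rule lead_add[OF lead_mult[OF lsite(1)] low1(1)]) (use IH(3)[of 0] n in \<open>simp_all add: weight_unit neg_one_less\<close>)
    have D: "lead N (y_op Q n * tB Q n $ 0 + k_op Q n * tD Q n $ 0) ((unit (VZ n) - unit (VX n)) + 0)"
      by (rule lead_add[OF lead_mult[OF lsite(6)] low1(2)]) (use IH(2)[of 0] n in \<open>simp_all add: weight_unit weight_diff neg_one_less\<close>)
    show ?thesis
      using A D IH(2,3)[of 0]
      by (simp only: 0 tower_nth ramp_0 add_0_left add_0_right diff_Suc_1 diff_zero add.commute le0 simp_thms)
  next
    case (Suc i)
    have e: "Suc n - 1 - Suc i = n - 1 - i" by simp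
    have A: "lead N (ki_op Q n * tA Q n $ Suc i + b_op n * tA Q n $ i + x_op n * tC Q n $ Suc i)
        (unit (VB n) + (ramp VB n i + unit (VX (n - 1 - i))))" if "i < n"
      using that nonneg[of i] pos[of "n - 1 - i"] n
      by (intro main lsite IH low1 low2) (simp_all add: weight_add weight_unit)
    have D: "lead N (k_op Q n * tD Q n $ Suc i + g_op n * tD Q n $ i + y_op Q n * tB Q n $ Suc i)
        (unit (VG n) + (ramp VG n i + (unit (VZ (n - 1 - i)) - unit (VX (n - 1 - i)))))" if "i < n"
      using that nonneg[of i] pos[of "n - 1 - i"] n
      by (intro main lsite IH low1 low2) (simp_all add: weight_add weight_unit)
    have B: "lead N (tB Q n $ Suc i + b_op n * k_op Q n * tB Q n $ i + scal Q * x_op n * k_op Q n * tD Q n $ i)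
        (unit (VB n) + ramp VB n i)" if "i \<le> n"
      using that nonneg[of i] n
      by (intro main leadk IH low low2) (simp_all add: weight_unit)
    have C: "lead N (tC Q n $ Suc i + g_op n * ki_op Q n * tC Q n $ i + scal Q * y_op Q n * ki_op Q n * tA Q n $ i)
        (unit (VG n) + ramp VG n i)" if "i \<le> n"
      using that nonneg[of i] n
      by (intro main leadk IH low low2) (simp_all add: weight_unit)
    show ?thesis
      using A B C D
      by (simp only: Suc tower_nth ramp_Suc less_imp_le Suc_less_eq Suc_le_mono e add.assoc simp_thms cong: imp_cong)
  qed
qed

section \<open>Independence of ordered words\<close>

lemma coeff_outer_inner:
  "(outer f * fps_const g) $ k $ l = f $ k * g $ l" "(fps_const g * outer f) $ k $ l = g $ l * f $ k"
  by simp_all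

text \<open>Coefficients are compared at \<open>s^k t^l\<close>, with indices shifted where a factor
  \<open>s\<close> or \<open>t\<close> occurs. The constant terms 1 of \<open>b\<close> and
  \<open>c\<close> produce the linear right-hand sides.\<close>

lemma half_exchange_coeffs:
  assumes "half_exchange (const2 Q) (const2 Qi) fps_X tvar (outer a) (fps_const a) (outer b) (fps_const b)
       (outer c) (fps_const c) (outer d) (fps_const d)"
    and [simp]: "b $ 0 = 1" "c $ 0 = 1"
  shows "a $ k * a $ l = a $ l * a $ k" "b $ k * b $ l = b $ l * b $ k"
    and "a $ k * b $ Suc l - b $ Suc l * a $ k = a $ l * b $ Suc k - b $ Suc k * a $ l"
    and "a $ k * c $ Suc l - c $ Suc l * a $ k = a $ l * c $ Suc k - c $ Suc k * a $ l"
    and "a $ k * d $ l - d $ l * a $ k = a $ l * d $ k - d $ k * a $ l"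
    and "c $ k * b $ l - b $ l * c $ k = c $ l * b $ k - b $ k * c $ l"
    and "a $ 0 * b $ k - Qi * (b $ k * a $ 0) = (1 - Qi) * a $ k"
    and "c $ k * a $ 0 - Qi * (a $ 0 * c $ k) = (1 - Qi) * a $ k"
    and "a $ 0 * d $ k - d $ k * a $ 0 = (1 - Qi) * (c $ Suc k - b $ Suc k)"
    and "a $ k * d $ 0 - d $ 0 * a $ k = (1 - Qi) * (c $ Suc k - b $ Suc k)"
proof -
  note cf = coeff_outer_inner
  have h: "outer a * fps_const a = fps_const a * outer a" "outer b * fps_const b = fps_const b * outer b"
    "fps_X * (outer a * fps_const b - fps_const b * outer a) = tvar * (fps_const a * outer b - outer b * fps_const a)"
    "outer a * fps_const b - const2 Qi * (fps_const b * outer a) = fps_const a * outer b - const2 Qi * (outer b * fps_const a)"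
    "fps_X * (outer a * fps_const c - fps_const c * outer a) = tvar * (fps_const a * outer c - outer c * fps_const a)"
    "fps_const c * outer a - const2 Qi * (outer a * fps_const c) = outer c * fps_const a - const2 Qi * (fps_const a * outer c)"
    "outer a * fps_const d - fps_const d * outer a = fps_const a * outer d - outer d * fps_const a"
    "(fps_X - tvar) * (outer a * fps_const d - fps_const d * outer a) = (1 - const2 Qi) * (fps_const b * outer c - outer b * fps_const c)"
    "outer c * fps_const b - fps_const b * outer c = fps_const c * outer b - outer b * fps_const c"
    using assms(1) unfolding half_exchange_def by blast+
  have nth: "x $ i $ j = y $ i $ j" if "x = y" for x y :: "'a fps fps" and i j using that by simp
  have X: "(fps_X * F) $ Suc k = F $ k" "(fps_X * F) $ 0 = 0" for F :: "'z::ring_1 fps" and k by simp_all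
  have K: "(const2 z * F) $ k $ l = z * F $ k $ l" "(tvar * F) $ k $ Suc l = F $ k $ l" "(tvar * F) $ k $ 0 = 0"
    for F :: "'a fps fps" and k l z by simp_all
  note coeff = fps_sub_nth X K cf
  show "a $ k * a $ l = a $ l * a $ k" "b $ k * b $ l = b $ l * b $ k"
    using nth[OF h(1), of k l] nth[OF h(2), of k l] unfolding cf .
  show "a $ k * b $ Suc l - b $ Suc l * a $ k = a $ l * b $ Suc k - b $ Suc k * a $ l"
    using nth[OF h(3), of "Suc k" "Suc l"] unfolding coeff .
  show "a $ k * c $ Suc l - c $ Suc l * a $ k = a $ l * c $ Suc k - c $ Suc k * a $ l"
    using nth[OF h(5), of "Suc k" "Suc l"] unfolding coeff .
  show "a $ k * d $ l - d $ l * a $ k = a $ l * d $ k - d $ k * a $ l"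
    using nth[OF h(7), of k l] unfolding coeff .
  show "c $ k * b $ l - b $ l * c $ k = c $ l * b $ k - b $ k * c $ l"
    using nth[OF h(9), of k l] unfolding coeff .
  show "a $ 0 * b $ k - Qi * (b $ k * a $ 0) = (1 - Qi) * a $ k"
    using nth[OF h(4), of 0 k] unfolding coeff by (simp add: left_diff_distrib)
  show "c $ k * a $ 0 - Qi * (a $ 0 * c $ k) = (1 - Qi) * a $ k"
    using nth[OF h(6), of 0 k] unfolding coeff by (simp add: left_diff_distrib)
  have "1 - const2 Qi = const2 (1 - Qi)" by (simp flip: fps_const_1_eq_1)
  note AD = nth[OF h(8)[unfolded this]]
  show "a $ 0 * d $ k - d $ k * a $ 0 = (1 - Qi) * (c $ Suc k - b $ Suc k)"
    using AD[of 0 "Suc k"] unfolding left_diff_distrib coeff by (simp add: algebra_simps)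
  show "a $ k * d $ 0 - d $ 0 * a $ k = (1 - Qi) * (c $ Suc k - b $ Suc k)"
    using AD[of "Suc k" 0] unfolding left_diff_distrib coeff by (simp add: algebra_simps)
qed

section \<open>Evaluation of the free algebra by operators\<close>

definition eval_hom :: "('g \<Rightarrow> ('e, 'f::field) lin_op) \<Rightarrow> ('g, 'f) free_algebra \<Rightarrow> ('e, 'f) lin_op" where
  "eval_hom \<rho> x = (\<Sum>w\<in>Poly_Mapping.keys x. scal (Poly_Mapping.lookup x w) * prod_list (map \<rho> w))"

lemma scal_simps: "scal (a + b) = scal a + scal b" "scal (a - b) = scal a - scal b" "scal (a * b) = scal a * scal b"
  "scal 1 = 1" "scal 0 = 0"
  by (transfer; simp add: fun_eq_iff algebra_simps)+

lemma free_algebra_induct [case_names 0 add]: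
  assumes "P 0" and "\<And>x w c. P x \<Longrightarrow> P (x + Poly_Mapping.single w c)"
  shows "P (x :: ('g, 'f::field) free_algebra)"
proof (induction x rule: update_induct)
  case const
  show ?case by (rule assms(1))
next
  case (update f a b)
  have "Poly_Mapping.update a b f = f + Poly_Mapping.single a b"
    using update(1) by (intro poly_mapping_eqI) (auto simp: lookup_update lookup_add lookup_single when_def in_keys_iff update.rep_eq)
  then show ?case using assms(2) update by simp
qed

lemma eval_hom_superset:
  assumes "finite S" "Poly_Mapping.keys x \<subseteq> S"
  shows "eval_hom \<rho> x = (\<Sum>w\<in>S. scal (Poly_Mapping.lookup x w) * prod_list (map \<rho> w))"
  unfolding eval_hom_def using assms
  by (intro sum.mono_neutral_left) (auto simp: in_keys_iff scal_simps)

lemma eval_hom_0 [simp]: "eval_hom \<rho> 0 = 0" by (simp add: eval_hom_def)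

lemma eval_hom_add: "eval_hom \<rho> (x + y) = eval_hom \<rho> x + eval_hom \<rho> y"
proof -
  let ?S = "Poly_Mapping.keys x \<union> Poly_Mapping.keys y"
  have "eval_hom \<rho> z = (\<Sum>w\<in>?S. scal (Poly_Mapping.lookup z w) * prod_list (map \<rho> w))"
    if "Poly_Mapping.keys z \<subseteq> ?S" for z
    using that by (intro eval_hom_superset) auto
  then show ?thesis
    using keys_add[of x y] by (simp add: lookup_add scal_simps distrib_right sum.distrib)
qed

lemma eval_hom_single: "eval_hom \<rho> (Poly_Mapping.single w c) = scal c * prod_list (map \<rho> w)"
  by (simp add: eval_hom_def scal_simps)

text \<open>Linearity in both arguments reduces this to words, where scalars pass through because
  they are central.\<close>

lemma eval_hom_mult: "eval_hom \<rho> (x * y) = eval_hom \<rho> x * eval_hom \<rho> y"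
proof (induction x rule: free_algebra_induct)
  case 0
  show ?case by simp
next
  case (add x w c)
  have "eval_hom \<rho> (Poly_Mapping.single w c * y) = eval_hom \<rho> (Poly_Mapping.single w c) * eval_hom \<rho> y"
  proof (induction y rule: free_algebra_induct)
    case 0
    show ?case by simp
  next
    case (add y v d)
    have "eval_hom \<rho> (Poly_Mapping.single w c * Poly_Mapping.single v d) =
        eval_hom \<rho> (Poly_Mapping.single w c) * eval_hom \<rho> (Poly_Mapping.single v d)"
    proof -
      have "prod_list (map \<rho> w) * (scal d * z) = scal d * (prod_list (map \<rho> w) * z)" for z
        using scal_central[of "prod_list (map \<rho> w)" d] by (simp flip: mult.assoc)
      then show ?thesis
        by (simp add: mult_single eval_hom_single plus_list_def scal_simps mult.assoc)
    qed
    with add show ?case by (simp add: distrib_left eval_hom_add)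
  qed
  with add show ?case by (simp add: distrib_right eval_hom_add)
qed

lemma eval_hom_diff: "eval_hom \<rho> (x - y) = eval_hom \<rho> x - eval_hom \<rho> y"
  using eval_hom_add[of \<rho> "x - y" y] by simp

lemma eval_hom_letter: "eval_hom \<rho> (letter g) = \<rho> g"
  by (simp add: letter_def eval_hom_single scal_simps)
lemma eval_hom_scalar: "eval_hom \<rho> (scalar c) = scal c"
  by (simp add: scalar_def eval_hom_single)

lemmas eval_hom_simps = eval_hom_add eval_hom_diff eval_hom_mult eval_hom_letter eval_hom_scalar

text \<open>The kernel of the evaluation is a two-sided ideal containing the relations, hence
  contains the ideal they generate.\<close>

lemma relation_ideal_minimal:
  fixes E :: "('g, 'f::field) free_algebra \<Rightarrow> ('g, 'f) free_algebra \<Rightarrow> bool"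
  assumes "\<And>x y. E x y \<Longrightarrow> eval_hom \<rho> x = eval_hom \<rho> y" and "x \<in> relation_ideal E"
  shows "eval_hom \<rho> x = 0"
proof -
  let ?J = "{x. eval_hom \<rho> x = 0}"
  have "ideal ?J class_ring"
  proof (rule idealI)
    show "ring (class_ring :: ('g, 'f) free_algebra ring)" by (rule class_ring.ring_axioms)
    show "subgroup ?J (add_monoid (class_ring :: ('g, 'f) free_algebra ring))"
    proof -
      interpret G: group "add_monoid (class_ring :: ('g, 'f) free_algebra ring)"
        by (rule abelian_group.a_group[OF ring.is_abelian_group[OF class_ring.ring_axioms]])
      show ?thesis
      proof (rule G.subgroupI)
        fix a assume a: "a \<in> ?J"
        have "inv\<^bsub>add_monoid (class_ring :: ('g, 'f) free_algebra ring)\<^esub> a = - a"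
          by (rule G.inv_equality) simp_all
        then show "inv\<^bsub>add_monoid (class_ring :: ('g, 'f) free_algebra ring)\<^esub> a \<in> ?J"
          using a eval_hom_diff[of \<rho> 0 a] by simp
      qed (auto simp: eval_hom_add intro: exI[of _ 0])
    qed
  qed (auto simp: eval_hom_mult)
  moreover have "{x - y | x y. E x y} \<subseteq> ?J"
    using assms(1) by (auto simp: eval_hom_diff)
  ultimately have "relation_ideal E \<subseteq> ?J"
    unfolding relation_ideal_def genideal_def by blast
  with assms(2) show ?thesis by blast
qed

text \<open>\<open>G k\<close> and \<open>Gt k\<close> stand for index \<open>k + 1\<close>, hence
  the coefficient \<open>Suc k\<close>; the constant terms of their series are 1.\<close>

fun rho :: "'f \<Rightarrow> nat \<Rightarrow> alt_gen \<Rightarrow> (expo, 'f::field) lin_op" where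
  "rho q N (Wneg k) = tA (q\<^sup>2) N $ k"
| "rho q N (G k) = tB (q\<^sup>2) N $ Suc k"
| "rho q N (Gt k) = tC (q\<^sup>2) N $ Suc k"
| "rho q N (Wpos k) = tD (q\<^sup>2) N $ k"

lemma tower_0: "tB Q N $ 0 = 1" "tC Q N $ 0 = 1"
  by (induction N) (simp_all add: tower_nth del: tB.simps tC.simps)

lemma rho_relations:
  assumes "q \<noteq> 0" "alt_rel q x y"
  shows "eval_hom (rho q N) x = eval_hom (rho q N) y"
proof -
  define a b c d where "a = tA (q\<^sup>2) N" and "b = tB (q\<^sup>2) N" and "c = tC (q\<^sup>2) N" and "d = tD (q\<^sup>2) N"
  have r: "rho q N (Wneg k) = a $ k" "rho q N (G k) = b $ Suc k" "rho q N (Gt k) = c $ Suc k"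
    "rho q N (Wpos k) = d $ k" for k
    by (simp_all add: a_def b_def c_def d_def)
  have ex: "exchange (scal (q\<^sup>2)) (scal (inverse (q\<^sup>2))) a b c d"
    unfolding a_def b_def c_def d_def using assms(1) by (intro exchange_tower_ops) simp
  have 0: "b $ 0 = 1" "c $ 0 = 1" by (simp_all add: b_def c_def tower_0)
  note H = half_exchange_coeffs[OF ex[unfolded exchange_def, THEN conjunct1] 0]
    and H' = half_exchange_coeffs[OF ex[unfolded exchange_def, THEN conjunct2] 0(2,1)]
  have "q * inverse (q\<^sup>2) = inverse q" using assms(1) by (simp add: power2_eq_square)
  then have s: "scal q * scal (inverse (q\<^sup>2)) = (scal (inverse q) :: (expo, 'a) lin_op)"
    by (simp flip: scal_simps(3))
  \<comment> \<open>Multiplication by \<open>q\<close> turns the coefficients 1 and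
    \<open>inverse (q\<^sup>2)\<close> of the exchange relations into those of the
    q-commutator.\<close>
  have qq: "scal q * (u - scal (inverse (q\<^sup>2)) * v) = scal q * u - scal (inverse q) * v"
    "scal q * ((1 - scal (inverse (q\<^sup>2))) * v) = (scal q - scal (inverse q)) * v" for u v :: "(expo, 'a) lin_op"
    unfolding right_diff_distrib left_diff_distrib mult_1_left mult.assoc [symmetric] s by (rule refl)+
  note ev = commutator_def q_commutator_def eval_hom_simps r mult.assoc eval_hom_0 Suc_eq_plus1 [symmetric] scal_simps
  have sum0: "(u - v) + (z - w) = 0" if "u - v = w - z" for u v w z :: "(expo, 'a) lin_op"
    using that by simp
  have diff0: "u - v = 0" if "u = v" for u v :: "(expo, 'a) lin_op"
    using that by simp
  from assms(2) show ?thesis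
  proof cases
    case (1 k) show ?thesis unfolding 1 ev by (rule H(9))
  next
    case (2 k) show ?thesis unfolding 2 ev by (rule H(10))
  next
    case (3 k) show ?thesis unfolding 3 ev using arg_cong[OF H(7)[of "Suc k"], of "(*) (scal q)"] unfolding qq .
  next
    case (4 k) show ?thesis unfolding 4 ev using arg_cong[OF H(8)[of "Suc k"], of "(*) (scal q)"] unfolding qq .
  next
    case (5 k) show ?thesis unfolding 5 ev using arg_cong[OF H'(8)[of "Suc k"], of "(*) (scal q)"] unfolding qq .
  next
    case (6 k) show ?thesis unfolding 6 ev using arg_cong[OF H'(7)[of "Suc k"], of "(*) (scal q)"] unfolding qq .
  next
    case (7 k l) show ?thesis unfolding 7 ev by (rule diff0[OF H(1)[of k l]])
  next
    case (8 k l) show ?thesis unfolding 8 ev by (rule diff0[OF H'(1)[of k l]])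
  next
    case (9 k l) show ?thesis unfolding 9 ev by (rule sum0[OF H(5)[of k l]])
  next
    case (10 k l) show ?thesis unfolding 10 ev by (rule sum0[OF H(3)[of k l]])
  next
    case (11 k l) show ?thesis unfolding 11 ev by (rule sum0[OF H(4)[of k l]])
  next
    case (12 k l) show ?thesis unfolding 12 ev by (rule sum0[OF H'(4)[of k l]])
  next
    case (13 k l) show ?thesis unfolding 13 ev by (rule sum0[OF H'(3)[of k l]])
  next
    case (14 k l) show ?thesis unfolding 14 ev by (rule diff0[OF H(2)[of "Suc k" "Suc l"]])
  next
    case (15 k l) show ?thesis unfolding 15 ev by (rule diff0[OF H'(2)[of "Suc k" "Suc l"]])
  next
    case (16 k l) show ?thesis unfolding 16 ev by (rule sum0[OF H(6)[of "Suc k" "Suc l"]])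
  qed
qed

section \<open>Leading exponents of words\<close>

fun index :: "alt_gen \<Rightarrow> nat" where
  "index (Wneg k) = k" | "index (G k) = k" | "index (Gt k) = k" | "index (Wpos k) = k"

fun lead_exp :: "nat \<Rightarrow> alt_gen \<Rightarrow> expo" where
  "lead_exp N (Wneg k) = ramp VB N k + unit (VX (N - 1 - k))"
| "lead_exp N (G k) = ramp VB N (Suc k)"
| "lead_exp N (Gt k) = ramp VG N (Suc k)"
| "lead_exp N (Wpos k) = ramp VG N k + (unit (VZ (N - 1 - k)) - unit (VX (N - 1 - k)))"

lemma lead_rho:
  assumes "q \<noteq> 0" "index g < N"
  shows "lead N (rho q N g) (lead_exp N g)"
  using assms lead_tower[of N N "q\<^sup>2" "index g"] lead_tower[of N N "q\<^sup>2" "Suc (index g)"]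
  by (cases g) auto

definition word_exp :: "nat \<Rightarrow> alt_gen list \<Rightarrow> expo" where
  "word_exp N w = (\<Sum>g\<leftarrow>w. lead_exp N g)"

lemma lead_word:
  assumes "q \<noteq> 0" "\<forall>g\<in>set w. index g < N"
  shows "lead N (prod_list (map (rho q N) w)) (word_exp N w)"
  using assms(2)
proof (induction w)
  case Nil
  show ?case using lead_1[of N] by (simp only: word_exp_def list.map prod_list.Nil sum_list.Nil)
next
  case (Cons g w)
  then have "lead N (prod_list (map (rho q N) w)) (word_exp N w)" "index g < N" by simp_all
  from lead_mult[OF lead_rho[OF assms(1) this(2)] this(1)] show ?case
    by (simp only: word_exp_def list.map prod_list.Cons sum_list.Cons)
qed

text \<open>Linear functionals that count a letter. The \<open>VZ\<close> exponent at site
  \<open>N - 1 - k\<close> counts \<open>Wpos k\<close>; adding the \<open>VX\<close> exponent there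
  gives the count of \<open>Wneg k\<close>. The \<open>VB\<close> exponents at sites
  \<open>N - 1 - k\<close> and \<open>N - 2 - k\<close> differ by the counts of \<open>G k\<close>
  and \<open>Wneg (k + 1)\<close>, and the latter is subtracted again. \<open>VG\<close> does the
  same for \<open>Gt k\<close> and \<open>Wpos (k + 1)\<close>.\<close>

fun multiplicity_of :: "nat \<Rightarrow> alt_gen \<Rightarrow> expo \<Rightarrow> int" where
  "multiplicity_of N (Wneg k) e = e (VX (N - 1 - k)) + e (VZ (N - 1 - k))"
| "multiplicity_of N (Wpos k) e = e (VZ (N - 1 - k))"
| "multiplicity_of N (G k) e = e (VB (N - 1 - k)) - e (VB (N - 2 - k)) - (e (VX (N - 2 - k)) + e (VZ (N - 2 - k)))"
| "multiplicity_of N (Gt k) e = e (VG (N - 1 - k)) - e (VG (N - 2 - k)) - e (VZ (N - 2 - k))"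

lemma ramp_apply:
  "ramp VB n i v = (case v of VB j \<Rightarrow> if n - i \<le> j \<and> j < n then 1 else 0 | _ \<Rightarrow> 0)"
  "ramp VG n i v = (case v of VG j \<Rightarrow> if n - i \<le> j \<and> j < n then 1 else 0 | _ \<Rightarrow> 0)"
proof -
  have *: "(\<Sum>j\<in>J. unit (V j)) v = (\<Sum>j\<in>J. unit (V j) v)" for J and V :: "nat \<Rightarrow> var"
    by (induction J rule: infinite_finite_induct) auto
  show "ramp VB n i v = (case v of VB j \<Rightarrow> if n - i \<le> j \<and> j < n then 1 else 0 | _ \<Rightarrow> 0)"
    "ramp VG n i v = (case v of VG j \<Rightarrow> if n - i \<le> j \<and> j < n then 1 else 0 | _ \<Rightarrow> 0)"
    unfolding ramp_def * unit_simps by (cases v; auto)+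
qed

text \<open>The functionals are dual to the leading exponents, which are therefore linearly
  independent. The margin 2 keeps \<open>N - 2 - k\<close> from being truncated.\<close>

lemma multiplicity_lead_exp:
  assumes "index g + 2 \<le> N" "index h + 2 \<le> N"
  shows "multiplicity_of N g (lead_exp N h) = (if g = h then 1 else 0)"
  using assms by (cases g; cases h) (auto simp: ramp_apply unit_simps)

lemma multiplicity_add: "multiplicity_of N g (e + f) = multiplicity_of N g e + multiplicity_of N g f"
  by (cases g) auto

lemma multiplicity_word_exp:
  assumes "index g + 2 \<le> N" "\<forall>h\<in>set w. index h + 2 \<le> N"
  shows "multiplicity_of N g (word_exp N w) = int (count (mset w) g)"
  using assms(2)
proof (induction w)
  case Nil
  show ?case by (cases g) (simp_all add: word_exp_def)
next
  case (Cons h w)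
  then show ?case
    using multiplicity_lead_exp[OF assms(1), of h]
    by (simp add: word_exp_def multiplicity_add del: plus_fun_apply)
qed

lemma word_exp_inj:
  assumes "\<forall>h\<in>set w. index h + 2 \<le> N" "\<forall>h\<in>set v. index h + 2 \<le> N" "word_exp N w = word_exp N v"
  shows "mset w = mset v"
proof (rule multiset_eqI)
  fix g
  show "count (mset w) g = count (mset v) g"
  proof (cases "index g + 2 \<le> N")
    case True
    then show ?thesis
      using multiplicity_word_exp[of g N w] multiplicity_word_exp[of g N v] assms by simp
  next
    case False
    then have "g \<notin> set w" "g \<notin> set v" using assms by auto
    then have "count (mset w) g = 0" "count (mset v) g = 0" by (simp_all add: count_eq_zero_iff)
    then show ?thesis by (simp only:)
  qed
qed

text \<open>A nonzero element of the ideal would act by zero, although its heaviest word contributes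
  a monomial that no other word reaches. Injectivity of \<open>mset\<close> keeps the leading
  exponents apart.\<close>

theorem ordered_words_independent:
  assumes q: "q \<noteq> 0" and x: "x \<in> relation_ideal (alt_rel q)"
    and inj: "inj_on mset (Poly_Mapping.keys x)"
  shows "x = 0"
proof (rule ccontr)
  assume "x \<noteq> 0"
  then have K: "finite (Poly_Mapping.keys x)" "Poly_Mapping.keys x \<noteq> {}" by auto
  \<comment> \<open>The height leaves the margin 2 above all indices that occur; the inserted 0
    makes \<open>Max\<close> meaningful even if only the empty word occurs.\<close>
  define N where "N = Max (insert 0 (index ` (\<Union>w\<in>Poly_Mapping.keys x. set w))) + 2"
  have N: "index g + 2 \<le> N" if "w \<in> Poly_Mapping.keys x" "g \<in> set w" for w g
    unfolding N_def using that by (intro add_right_mono Max_ge) auto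
  define \<phi> :: "expo \<Rightarrow> 'a" where "\<phi> = (\<lambda>e. if e = 0 then 1 else 0)"
  have "top_at N \<phi> 0" by (simp add: top_at_def \<phi>_def)
  then have top: "top_at N (app (prod_list (map (rho q N) w)) \<phi>) (word_exp N w)" if "w \<in> Poly_Mapping.keys x" for w
    using lead_word[OF q, of w N] N[OF that] unfolding lead_def by fastforce
  obtain w where w: "w \<in> Poly_Mapping.keys x"
    and max: "\<And>v. v \<in> Poly_Mapping.keys x \<Longrightarrow> weight N (word_exp N v) \<le> weight N (word_exp N w)"
  proof -
    let ?M = "Max ((\<lambda>v. weight N (word_exp N v)) ` Poly_Mapping.keys x)"
    have "?M \<in> (\<lambda>v. weight N (word_exp N v)) ` Poly_Mapping.keys x"
      using K by (intro Max_in) auto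
    then obtain w where "w \<in> Poly_Mapping.keys x" "?M = weight N (word_exp N w)" by blast
    moreover have "weight N (word_exp N v) \<le> ?M" if "v \<in> Poly_Mapping.keys x" for v
      using that by (intro Max_ge) auto
    ultimately show thesis using that by metis
  qed
  \<comment> \<open>Except at \<open>word_exp N v\<close>, the image under \<open>v\<close> lives
    strictly below the weight of \<open>word_exp N v\<close>, which is at most that of
    \<open>word_exp N w\<close>.\<close>
  have other: "app (prod_list (map (rho q N) v)) \<phi> (word_exp N w) = 0" if v: "v \<in> Poly_Mapping.keys x" "v \<noteq> w" for v
  proof -
    have "word_exp N v \<noteq> word_exp N w"
      using word_exp_inj[of v N w] inj v w N unfolding inj_on_def by blast
    then show ?thesis using top[OF v(1)] max[OF v(1)] unfolding top_at_def by force
  qed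
  have app_sum: "app (\<Sum>v\<in>S. F v) \<phi> e = (\<Sum>v\<in>S. app (F v) \<phi> e)" for S and F :: "alt_gen list \<Rightarrow> (expo, 'a) lin_op" and e
    by (induction S rule: infinite_finite_induct) (simp_all add: app_simps)
  have "0 = app (eval_hom (rho q N) x) \<phi> (word_exp N w)"
    using relation_ideal_minimal[OF rho_relations[OF q] x] by (simp add: app_simps)
  also have "\<dots> = (\<Sum>v\<in>Poly_Mapping.keys x. Poly_Mapping.lookup x v * app (prod_list (map (rho q N) v)) \<phi> (word_exp N w))"
    by (simp add: eval_hom_def app_sum app_simps)
  also have "\<dots> = Poly_Mapping.lookup x w * app (prod_list (map (rho q N) w)) \<phi> (word_exp N w)"
    using w K(1) other by (subst sum.remove[of _ w]) auto
  also have "\<dots> \<noteq> 0" using top[OF w] w by (simp add: top_at_def in_keys_iff)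
  finally show False by simp
qed

section \<open>Consequences of the defining relations\<close>

text \<open>Relations are congruences modulo an ideal, so consequences reduce to identities in the
  ambient ring. In the intended instance \<open>p\<close> is the inverse of \<open>q\<close>,
  \<open>m\<close> that of \<open>q - p\<close>, and \<open>b 0 = c 0 = 1\<close>, which extends the
  relations to index 0.\<close>

locale alternating_relations =
  fixes I :: "'r::ring_1 set" and q p m :: 'r and a b c d :: "nat \<Rightarrow> 'r"
  assumes I_add: "x \<in> I \<Longrightarrow> y \<in> I \<Longrightarrow> x + y \<in> I"
    and I_left: "x \<in> I \<Longrightarrow> z * x \<in> I" and I_right: "x \<in> I \<Longrightarrow> x * z \<in> I"
    and q_central: "z * q = q * z" and p_central: "z * p = p * z"
    and qp: "q * p = 1" and m: "m * (q - p) = 1"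
    and AD1: "a 0 * d k - d k * a 0 - (1 - p * p) * (c (Suc k) - b (Suc k)) \<in> I"
    and AD2: "a k * d 0 - d 0 * a k - (1 - p * p) * (c (Suc k) - b (Suc k)) \<in> I"
    and AB1: "q * a 0 * b k - p * b k * a 0 - (q - p) * a k \<in> I"
    and AC1: "q * c k * a 0 - p * a 0 * c k - (q - p) * a k \<in> I"
    and DB1: "q * b k * d 0 - p * d 0 * b k - (q - p) * d k \<in> I"
    and DC1: "q * d 0 * c k - p * c k * d 0 - (q - p) * d k \<in> I"
    and AA: "a k * a l - a l * a k \<in> I" and BB: "b k * b l - b l * b k \<in> I"
    and CC: "c k * c l - c l * c k \<in> I" and DD: "d k * d l - d l * d k \<in> I"
    and AB2: "a k * b (Suc l) - b (Suc l) * a k - (a l * b (Suc k) - b (Suc k) * a l) \<in> I"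
    and AC2: "a k * c (Suc l) - c (Suc l) * a k - (a l * c (Suc k) - c (Suc k) * a l) \<in> I"
    and DB2: "d k * b (Suc l) - b (Suc l) * d k - (d l * b (Suc k) - b (Suc k) * d l) \<in> I"
    and DC2: "d k * c (Suc l) - c (Suc l) * d k - (d l * c (Suc k) - c (Suc k) * d l) \<in> I"
    and AD4: "a k * d l - d l * a k - (a l * d k - d k * a l) \<in> I"
    and CB5: "c k * b l - b l * c k - (c l * b k - b k * c l) \<in> I"
begin

lemma I_uminus: "x \<in> I \<Longrightarrow> - x \<in> I"
  using I_left[of x "-1"] by simp

lemma I_diff: "x \<in> I \<Longrightarrow> y \<in> I \<Longrightarrow> x - y \<in> I"
  using I_add[OF _ I_uminus, of x y] by simp

lemma I_cancel: "(q - p) * x \<in> I \<Longrightarrow> x \<in> I"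
  using I_left[of "(q - p) * x" m] m by (simp flip: mult.assoc)

lemma pq: "p * q = 1" using qp p_central[of q] by simp

lemma central_rules:
  "a k * q = q * a k" "b k * q = q * b k" "c k * q = q * c k" "d k * q = q * d k"
  "a k * p = p * a k" "b k * p = p * b k" "c k * p = p * c k" "d k * p = p * d k"
  "a k * (q * z) = q * (a k * z)" "b k * (q * z) = q * (b k * z)" "c k * (q * z) = q * (c k * z)" "d k * (q * z) = q * (d k * z)"
  "a k * (p * z) = p * (a k * z)" "b k * (p * z) = p * (b k * z)" "c k * (p * z) = p * (c k * z)" "d k * (p * z) = p * (d k * z)"
  "q * p = 1" "p * q = 1" "q * (p * z) = z" "p * (q * z) = z"
  using q_central p_central qp pq by (metis mult.assoc mult_1_left)+

definition "ab1 k = q * a 0 * b k - p * b k * a 0 - (q - p) * a k"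
definition "ac1 k = q * c k * a 0 - p * a 0 * c k - (q - p) * a k"
definition "db1 k = q * b k * d 0 - p * d 0 * b k - (q - p) * d k"
definition "dc1 k = q * d 0 * c k - p * c k * d 0 - (q - p) * d k"
definition "ad2 k = a k * d 0 - d 0 * a k - (1 - p * p) * (c (Suc k) - b (Suc k))"
definition "bb k l = b k * b l - b l * b k"
definition "cc k l = c k * c l - c l * c k"
definition "ab2 k l = a k * b (Suc l) - b (Suc l) * a k - (a l * b (Suc k) - b (Suc k) * a l)"
definition "ad4 k l = a k * d l - d l * a k - (a l * d k - d k * a l)"
definition "cb5 k l = c k * b l - b l * c k - (c l * b k - b k * c l)"
definition "ac3 k l = q * c k * a l - p * a l * c k - (q * c l * a k - p * a k * c l)"

lemmas rel_defs = ab1_def ac1_def db1_def dc1_def ad2_def bb_def cc_def ab2_def ad4_def cb5_def ac3_def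

lemma rel_in_I: "ab1 k \<in> I" "ac1 k \<in> I" "db1 k \<in> I" "dc1 k \<in> I" "ad2 k \<in> I" "bb k l \<in> I" "cc k l \<in> I"
  "ab2 k l \<in> I" "ad4 k l \<in> I" "cb5 k l \<in> I"
  unfolding rel_defs by (rule AB1 AC1 DB1 DC1 AD2 BB CC AB2 AD4 CB5)+

text \<open>Modulo \<open>I\<close>, \<open>(q - p) * a k\<close> is the q-commutator of
  \<open>a 0\<close> and \<open>b k\<close>. Its q-commutator with \<open>b l\<close> is symmetric
  in \<open>k\<close> and \<open>l\<close> because the \<open>b\<close> commute.\<close>

lemma AB3: "q * a k * b l - p * b l * a k - (q * a l * b k - p * b k * a l) \<in> I" (is "?x \<in> I")
proof (rule I_cancel)
  have "(q - p) * ?x = p * b l * ab1 k - q * ab1 k * b l + q * ab1 l * b k - p * b k * ab1 l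
      + q * q * a 0 * bb k l - p * p * bb k l * a 0"
    unfolding rel_defs by (simp add: algebra_simps central_rules)
  also have "\<dots> \<in> I" by (intro I_add I_diff I_left I_right rel_in_I)
  finally show "(q - p) * ?x \<in> I" .
qed

text \<open>The argument for \<open>AB3\<close>, with the q-commutator of \<open>c k\<close> and
  \<open>a 0\<close>.\<close>

lemma AC3: "ac3 k l \<in> I"
proof (rule I_cancel)
  have "(q - p) * ac3 k l = p * ac1 l * c k - q * c k * ac1 l + q * c l * ac1 k - p * ac1 k * c l
      + q * q * cc k l * a 0 - p * p * a 0 * cc k l"
    unfolding rel_defs by (simp add: algebra_simps central_rules)
  also have "\<dots> \<in> I" by (intro I_add I_diff I_left I_right rel_in_I)
  finally show "(q - p) * ac3 k l \<in> I" .
qed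

text \<open>Write \<open>(q - p) * d (Suc j)\<close> as the q-commutator of \<open>b (Suc j)\<close>
  and \<open>d 0\<close>, commute with \<open>a k\<close> by the Leibniz rule, and antisymmetrise in
  \<open>k\<close> and \<open>j\<close>. The commutators of \<open>a\<close> and \<open>b\<close>
  cancel by \<open>ab2\<close>, those of \<open>a\<close> and \<open>d 0\<close> are given by
  \<open>ad2\<close>, and \<open>ad4\<close> moves the index shift.\<close>

lemma AD6: "a k * d (Suc j) - d (Suc j) * a k - (a (Suc k) * d j - d j * a (Suc k))
    - (1 - p * p) * (b (Suc j) * c (Suc k) - b (Suc k) * c (Suc j)) \<in> I" (is "?x \<in> I")
proof (rule I_cancel)
  have "(q - p) * ?x = q * ab2 k j * d 0 - p * d 0 * ab2 k j + q * b (Suc j) * ad2 k - p * ad2 k * b (Suc j)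
      - q * b (Suc k) * ad2 j + p * ad2 j * b (Suc k) - a k * db1 (Suc j) + db1 (Suc j) * a k
      + a j * db1 (Suc k) - db1 (Suc k) * a j - (q - p) * ad4 (Suc k) j
      + (1 - p * p) * ((q + p) * bb (Suc k) (Suc j) - p * cb5 (Suc k) (Suc j))"
    unfolding rel_defs by (simp add: algebra_simps central_rules)
  also have "\<dots> \<in> I" by (intro I_add I_diff I_left I_right rel_in_I)
  finally show "(q - p) * ?x \<in> I" .
qed

text \<open>By \<open>ad2\<close>, \<open>b (Suc j)\<close> is \<open>c (Suc j)\<close> up to a
  multiple of the commutator of \<open>a j\<close> and \<open>d 0\<close>. Moving \<open>c k\<close>
  past \<open>d 0\<close> produces \<open>d k\<close> by \<open>dc1\<close>; after
  antisymmetrisation the remaining q-commutators of \<open>c\<close> and \<open>a\<close> cancel by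
  \<open>AC3\<close>.\<close>

lemma CB7: "c k * b (Suc j) - b (Suc j) * c k - (c (Suc k) * b j - b j * c (Suc k))
    + (q * q - 1) * (a j * d k - a k * d j) \<in> I" (is "?x \<in> I")
proof (rule I_cancel)
  have "(q - p) * ?x = (q - p) * (cc k (Suc j) - cc j (Suc k) - cb5 (Suc k) j) + (q * q - 1) * q * ad4 j k
      + (q * c k * ad2 j - q * ad2 j * c k - q * q * dc1 k * a j + a j * dc1 k)
      - (q * c j * ad2 k - q * ad2 k * c j - q * q * dc1 j * a k + a k * dc1 j)
      + q * q * d 0 * ac3 k j - ac3 k j * d 0"
    unfolding rel_defs by (simp add: algebra_simps central_rules)
  also have "\<dots> \<in> I" by (intro I_add I_diff I_left I_right rel_in_I AC3)
  finally show "(q - p) * ?x \<in> I" .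
qed

text \<open>By this symmetry the straightening of pairs with \<open>d\<close> follows the pattern of
  those with \<open>a\<close>.\<close>

lemma swap: "alternating_relations I q p m d c b a"
proof unfold_locales
  fix k
  show "d 0 * a k - a k * d 0 - (1 - p * p) * (b (Suc k) - c (Suc k)) \<in> I"
    using I_uminus[OF AD2[of k]] by (simp add: algebra_simps)
  show "d k * a 0 - a 0 * d k - (1 - p * p) * (b (Suc k) - c (Suc k)) \<in> I"
    using I_uminus[OF AD1[of k]] by (simp add: algebra_simps)
  fix l
  show "d k * a l - a l * d k - (d l * a k - a k * d l) \<in> I"
    using AD4[of k l] by (simp add: algebra_simps)
  show "b k * c l - c l * b k - (b l * c k - c k * b l) \<in> I"
    using CB5[of k l] by (simp add: algebra_simps)
qed (rule I_add I_left I_right q_central p_central qp m AB1 AC1 DB1 DC1 AA BB CC DD AB2 AC2 DB2 DC2; assumption?)+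

end

section \<open>Straightening\<close>

lemma relation_ideal_closed:
  fixes E :: "('g, 'f::field) free_algebra \<Rightarrow> ('g, 'f) free_algebra \<Rightarrow> bool"
  shows "x \<in> relation_ideal E \<Longrightarrow> y \<in> relation_ideal E \<Longrightarrow> x + y \<in> relation_ideal E"
    "x \<in> relation_ideal E \<Longrightarrow> z * x \<in> relation_ideal E" "x \<in> relation_ideal E \<Longrightarrow> x * z \<in> relation_ideal E"
    "0 \<in> relation_ideal E" "E u v \<Longrightarrow> u - v \<in> relation_ideal E"
proof -
  have R: "ring (class_ring :: ('g, 'f) free_algebra ring)" by (rule class_ring.ring_axioms)
  have I: "ideal (relation_ideal E) class_ring"
    unfolding relation_ideal_def using ring.genideal_ideal[OF R, of "{x - y | x y. E x y}"] by simp
  interpret ideal "relation_ideal E" class_ring by (rule I)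
  show "x \<in> relation_ideal E \<Longrightarrow> y \<in> relation_ideal E \<Longrightarrow> x + y \<in> relation_ideal E"
    "x \<in> relation_ideal E \<Longrightarrow> z * x \<in> relation_ideal E" "x \<in> relation_ideal E \<Longrightarrow> x * z \<in> relation_ideal E"
    "0 \<in> relation_ideal E"
    using a_closed[of x y] I_l_closed[of x z] I_r_closed[of x z] additive_subgroup.zero_closed[OF additive_subgroup_axioms] by auto
  show "E u v \<Longrightarrow> u - v \<in> relation_ideal E"
    unfolding relation_ideal_def using ring.genideal_self[OF R, of "{x - y | x y. E x y}"] by auto
qed

section \<open>Spans of words modulo an ideal\<close>

abbreviation word :: "'g list \<Rightarrow> ('g, 'f::field) free_algebra" where "word w \<equiv> Poly_Mapping.single w 1"

lemma word_mult: "word u * word v = word (u @ v)" by (simp add: mult_single plus_list_def)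
lemma single_eq_word: "Poly_Mapping.single w c = scalar c * word w"
  by (simp add: scalar_def mult_single plus_list_def)
lemma word_Nil: "word [] = 1" by (simp flip: zero_list_def)

text \<open>Congruence in the free algebra stands in for membership in a span of the
  quotient.\<close>

definition word_span :: "('g, 'f::field) free_algebra set \<Rightarrow> 'g list set \<Rightarrow> ('g, 'f) free_algebra set" where
  "word_span I W = {x. \<exists>y. Poly_Mapping.keys y \<subseteq> W \<and> x - y \<in> I}"

locale two_sided_ideal =
  fixes I :: "('g, 'f::field) free_algebra set"
  assumes zero: "0 \<in> I" and add: "x \<in> I \<Longrightarrow> y \<in> I \<Longrightarrow> x + y \<in> I"
    and left: "x \<in> I \<Longrightarrow> z * x \<in> I" and right: "x \<in> I \<Longrightarrow> x * z \<in> I"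
begin

lemma span_word: "w \<in> W \<Longrightarrow> word w \<in> word_span I W"
  unfolding word_span_def using zero by (intro CollectI exI[of _ "word w"]) simp

lemma span_0: "0 \<in> word_span I W"
  unfolding word_span_def using zero by (intro CollectI exI[of _ 0]) simp

lemma span_add:
  assumes "x \<in> word_span I W" "y \<in> word_span I W"
  shows "x + y \<in> word_span I W"
proof -
  from assms obtain x' y' where "Poly_Mapping.keys x' \<subseteq> W" "Poly_Mapping.keys y' \<subseteq> W" "x - x' \<in> I" "y - y' \<in> I"
    unfolding word_span_def by blast
  moreover from this have "x + y - (x' + y') \<in> I"
    using add[of "x - x'" "y - y'"] by (simp only: add_diff_add)
  ultimately show ?thesis
    using keys_add[of x' y'] unfolding word_span_def by (intro CollectI exI[of _ "x' + y'"]) blast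
qed

lemma span_scalar:
  assumes "x \<in> word_span I W"
  shows "scalar e * x \<in> word_span I W"
proof -
  from assms obtain x' where x': "Poly_Mapping.keys x' \<subseteq> W" "x - x' \<in> I"
    unfolding word_span_def by blast
  have "Poly_Mapping.keys (scalar e * x') \<subseteq> Poly_Mapping.keys x'"
    using keys_mult[of "scalar e" x'] by (auto simp: scalar_def plus_list_def split: if_splits)
  moreover have "scalar e * x - scalar e * x' \<in> I"
    using left[OF x'(2), of "scalar e"] by (simp only: right_diff_distrib)
  ultimately show ?thesis
    using x'(1) unfolding word_span_def by blast
qed

lemma span_diff: "x \<in> word_span I W \<Longrightarrow> y \<in> word_span I W \<Longrightarrow> x - y \<in> word_span I W"
proof -
  have "scalar (-1) * y = - y"
    by (simp add: scalar_def single_uminus) (simp flip: zero_list_def)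
  then show "x \<in> word_span I W \<Longrightarrow> y \<in> word_span I W \<Longrightarrow> x - y \<in> word_span I W"
    using span_add[of x W "- y"] span_scalar[of y W "-1"] by simp
qed

lemma span_cong: "x - y \<in> I \<Longrightarrow> y \<in> word_span I W \<Longrightarrow> x \<in> word_span I W"
proof -
  assume xy: "x - y \<in> I" and "y \<in> word_span I W"
  then obtain y' where y': "Poly_Mapping.keys y' \<subseteq> W" "y - y' \<in> I" unfolding word_span_def by blast
  have "x - y' \<in> I" using add[OF xy y'(2)] by simp
  with y'(1) show ?thesis unfolding word_span_def by blast
qed

lemma free_in_span: 
  assumes "\<And>w. w \<in> Poly_Mapping.keys y \<Longrightarrow> word w \<in> word_span I W"
  shows "y \<in> word_span I W"
  using assms
proof (induction y rule: update_induct)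
  case const
  show ?case by (rule span_0)
next
  case (update f v e)
  have eq: "Poly_Mapping.update v e f = f + scalar e * word v"
    using update(1) by (intro poly_mapping_eqI)
      (auto simp: scalar_def mult_single plus_list_def lookup_update lookup_add lookup_single when_def in_keys_iff update.rep_eq)
  have keys: "Poly_Mapping.keys (Poly_Mapping.update v e f) = insert v (Poly_Mapping.keys f)"
    using update(1,2) by (auto simp: in_keys_iff lookup_update split: if_splits)
  show ?case
    unfolding eq using update keys by (intro span_add span_scalar update) auto
qed

lemma span_trans:
  assumes x: "x \<in> word_span I V" and "\<And>w. w \<in> V \<Longrightarrow> word w \<in> word_span I W"
  shows "x \<in> word_span I W"
  using x free_in_span[of _ W] assms(2) span_cong unfolding word_span_def[of I V] by blast

text \<open>This lets a rewriting rule for a factor act inside a longer word.\<close>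

lemma span_sandwich:
  assumes "x \<in> word_span I W"
  shows "word u * x * word v \<in> word_span I ((\<lambda>w. u @ w @ v) ` W)"
proof -
  from assms obtain x' where x': "Poly_Mapping.keys x' \<subseteq> W" "x - x' \<in> I"
    unfolding word_span_def by blast
  have "Poly_Mapping.keys (word u * x' * word v) \<subseteq> (\<lambda>w. u @ w @ v) ` W"
    using keys_mult[of "word u * x'" "word v"] keys_mult[of "word u" x'] x'(1)
    by (fastforce simp: plus_list_def split: if_splits)
  moreover have "word u * x * word v - word u * x' * word v \<in> I"
    using right[OF left[OF x'(2), of "word u"], of "word v"] by (simp add: algebra_simps)
  ultimately show ?thesis unfolding word_span_def by blast
qed

end

section \<open>Degrees and termination of rewriting\<close>

fun degree :: "alt_gen \<Rightarrow> nat" where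
  "degree (Wneg k) = 2 * k + 1" | "degree (Wpos k) = 2 * k + 1"
| "degree (G k) = 2 * k + 2" | "degree (Gt k) = 2 * k + 2"

definition total_degree :: "alt_gen list \<Rightarrow> nat" where "total_degree w = (\<Sum>g\<leftarrow>w. degree g)"
definition degree_squares :: "alt_gen list \<Rightarrow> nat" where "degree_squares w = (\<Sum>g\<leftarrow>w. (degree g)\<^sup>2)"

lemma squares_le: "degree_squares w \<le> (total_degree w)\<^sup>2"
  by (induction w) (auto simp: degree_squares_def total_degree_def power2_sum)

fun inversions :: "alt_gen rel \<Rightarrow> alt_gen list \<Rightarrow> nat" where
  "inversions r [] = 0"
| "inversions r (g # w) = length (filter (\<lambda>h. (g, h) \<notin> r) w) + inversions r w"

lemma inversions_swap:
  "(g, h) \<in> r \<Longrightarrow> (h, g) \<notin> r \<Longrightarrow> inversions r (u @ [g, h] @ v) < inversions r (u @ [h, g] @ v)"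
  by (induction u) auto

text \<open>For a transitive relation sortedness is decided by neighbours.\<close>

lemma unsorted_split:
  assumes "trans r" "\<not> sorted_wrt (\<lambda>a b. (a, b) \<in> r) w"
  obtains u h g v where "w = u @ [h, g] @ v" "(h, g) \<notin> r"
proof -
  have "transp (\<lambda>a b. (a, b) \<in> r)" using assms(1) by (simp add: trans_def transp_def)
  then obtain i where i: "Suc i < length w" "(w ! i, w ! Suc i) \<notin> r"
    using assms(2) by (auto simp: sorted_wrt_iff_nth_Suc_transp)
  have "w = take i w @ [w ! i, w ! Suc i] @ drop (Suc (Suc i)) w"
    using i(1) by (simp add: Cons_nth_drop_Suc)
  with i(2) show thesis using that by blast
qed

definition higher :: "alt_gen list \<Rightarrow> alt_gen list set" where
  "higher w = {v. total_degree v = total_degree w \<and> degree_squares w < degree_squares v}"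

theorem straightening:
  fixes r :: "alt_gen rel" and J :: "(alt_gen, 'f::field) free_algebra set"
  assumes "two_sided_ideal J" and r: "linear_order_on UNIV r"
    and pair: "\<And>h g. (h, g) \<notin> r \<Longrightarrow> word [h, g] \<in> word_span J (insert [g, h] (higher [h, g]))"
  shows "word w \<in> word_span J {w. sorted_wrt (\<lambda>a b. (a, b) \<in> r) w}"
proof -
  interpret J: two_sided_ideal J by (rule assms(1))
  have tr: "trans r" and tot: "total_on UNIV r"
    using r by (auto simp: linear_order_on_def partial_order_on_def preorder_on_def)
  have refl: "refl r" using r by (auto simp: linear_order_on_def partial_order_on_def preorder_on_def)
  show ?thesis
  \<comment> \<open>Lexicographic measure: a higher word lowers the first component, while a plain
    swap keeps it and removes an inversion.\<close>
  proof (induction w rule: wf_induct_rule[OF wf_measures[of "[\<lambda>w. (total_degree w)\<^sup>2 - degree_squares w, inversions r]"]])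
    case (1 w)
    show ?case
    proof (cases "sorted_wrt (\<lambda>a b. (a, b) \<in> r) w")
      case True
      then show ?thesis by (intro J.span_word) simp
    next
      case False
      then obtain u h g v where w: "w = u @ [h, g] @ v" and hg: "(h, g) \<notin> r"
        using unsorted_split[OF tr] by metis
      then have gh: "(g, h) \<in> r" using tot refl unfolding total_on_def refl_on_def by (cases "g = h") auto
      have "word w = word u * word [h, g] * word v"
        by (simp add: w word_mult)
      also have "\<dots> \<in> word_span J ((\<lambda>x. u @ x @ v) ` insert [g, h] (higher [h, g]))"
        by (rule J.span_sandwich[OF pair[OF hg]])
      finally show ?thesis
      proof (rule J.span_trans)
        fix z assume "z \<in> (\<lambda>x. u @ x @ v) ` insert [g, h] (higher [h, g])"
        then consider "z = u @ [g, h] @ v" | x where "z = u @ x @ v" "x \<in> higher [h, g]" by auto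
        then have "(z, w) \<in> measures [\<lambda>w. (total_degree w)\<^sup>2 - degree_squares w, inversions r]"
        proof cases
          case 1
          then have "total_degree z = total_degree w" "degree_squares z = degree_squares w" "inversions r z < inversions r w"
            using inversions_swap[OF gh hg, of u v] by (simp_all add: w total_degree_def degree_squares_def)
          then show ?thesis by simp
        next
          case 2
          then have eq: "total_degree z = total_degree w" and less: "degree_squares z > degree_squares w"
            by (simp_all add: w total_degree_def degree_squares_def higher_def)
          \<comment> \<open>This bound prevents the truncated subtraction from giving 0 on both
            sides.\<close>
          from squares_le[of z] have "degree_squares z \<le> (total_degree w)\<^sup>2" by (simp only: eq)
          with less have "(total_degree w)\<^sup>2 - degree_squares z < (total_degree w)\<^sup>2 - degree_squares w" by linarith
          then show ?thesis by (simp add: eq)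
        qed
        then show "word z \<in> word_span J {w. sorted_wrt (\<lambda>a b. (a, b) \<in> r) w}" by (rule 1)
      qed
    qed
  qed
qed

text \<open>The words of \<open>G\<close> and \<open>G\<close> tilde with index \<open>k\<close> rather than \<open>k + 1\<close>; index 0 is the unit.\<close>

fun bword cword :: "nat \<Rightarrow> alt_gen list" where
  "bword 0 = []" | "bword (Suc k) = [G k]" | "cword 0 = []" | "cword (Suc k) = [Gt k]"

lemma total_words: "total_degree [] = 0" "total_degree (u @ v) = total_degree u + total_degree v" "total_degree (g # v) = degree g + total_degree v"
  "total_degree (bword k) = 2 * k" "total_degree (cword k) = 2 * k"
  by (simp_all add: total_degree_def) (cases k; simp)+
lemma squares_words: "degree_squares [] = 0" "degree_squares (u @ v) = degree_squares u + degree_squares v" "degree_squares (g # v) = (degree g)\<^sup>2 + degree_squares v"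
  "degree_squares (bword k) = (2 * k)\<^sup>2" "degree_squares (cword k) = (2 * k)\<^sup>2"
proof -
  show "degree_squares (bword k) = (2 * k)\<^sup>2" "degree_squares (cword k) = (2 * k)\<^sup>2"
    by (cases k; simp add: degree_squares_def power2_eq_square)+
qed (simp_all add: degree_squares_def)

lemma commutator_eq: "commutator x y = x * y - y * x" by (simp add: commutator_def)

lemma scalar_diff: "scalar (x - y) = scalar x - scalar y"
  by (simp add: scalar_def single_diff)

theorem alternating_relations_free:
  fixes q :: "'f::field"
  assumes q: "q \<noteq> 0" "q\<^sup>2 \<noteq> 1"
  shows "alternating_relations (relation_ideal (alt_rel q)) (scalar q) (scalar (inverse q)) (scalar (inverse (q - inverse q)))
    (\<lambda>k. word [Wneg k]) (\<lambda>k. word (bword k)) (\<lambda>k. word (cword k)) (\<lambda>k. word [Wpos k])"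
proof -
  let ?I = "relation_ideal (alt_rel q)"
  have R: "alt_rel q x y \<Longrightarrow> x - y \<in> ?I" for x y by (rule relation_ideal_closed)
  have q2: "q - inverse q \<noteq> 0" using q by (auto simp: field_simps power2_eq_square)
  have qq: "scalar (inverse (q\<^sup>2)) = (scalar (inverse q) * scalar (inverse q) :: (alt_gen, 'f) free_algebra)"
    by (simp add: power2_eq_square flip: scalar_simps(2))
  have bs: "word (bword (Suc k)) = gg k" "word (cword (Suc k)) = gt k" "word [Wneg k] = wn k" "word [Wpos k] = wp k"
    "word (bword 0) = 1" "word (cword 0) = 1" for k
    by (simp_all add: letter_def word_Nil)
  note rel = commutator_eq q_commutator_def scalar_diff qq scalar_simps(3) diff_0_right add_0_left Suc_eq_plus1 [symmetric]
  have z: "0 \<in> ?I" by (rule relation_ideal_closed)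
  show ?thesis
  proof (unfold_locales, goal_cases)
    case (1 x y) then show ?case by (rule relation_ideal_closed)
  next
    case (2 x z) then show ?case by (rule relation_ideal_closed)
  next
    case (3 x z) then show ?case by (rule relation_ideal_closed)
  next
    case (4 z) then show ?case by (rule scalar_commute[symmetric])
  next
    case (5 z) then show ?case by (rule scalar_commute[symmetric])
  next
    case 6 then show ?case using q by (simp add: scalar_simps(3) flip: scalar_simps(2))
  next
    case 7 then show ?case using q2 by (simp add: scalar_simps(3) flip: scalar_simps(2) scalar_diff)
  next
    case (8 k) show ?case unfolding bs using R[OF alt_rel.intros(1), of k] unfolding rel .
  next
    case (9 k) show ?case unfolding bs using R[OF alt_rel.intros(2), of k] unfolding rel .
  next
    \<comment> \<open>For index 0 the word is the unit and the relation is an identity; the defining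
      relations cover the successors. The same split recurs below.\<close>
    case (10 k) show ?case
    proof (cases k)
      case 0 show ?thesis unfolding 0 bs by (simp add: z left_diff_distrib)
    next
      case (Suc k) show ?thesis unfolding Suc bs using R[OF alt_rel.intros(3), of k] unfolding rel .
    qed
  next
    case (11 k) show ?case
    proof (cases k)
      case 0 show ?thesis unfolding 0 bs by (simp add: z left_diff_distrib)
    next
      case (Suc k) show ?thesis unfolding Suc bs using R[OF alt_rel.intros(4), of k] unfolding rel .
    qed
  next
    case (12 k) show ?case
    proof (cases k)
      case 0 show ?thesis unfolding 0 bs by (simp add: z left_diff_distrib)
    next
      case (Suc k) show ?thesis unfolding Suc bs using R[OF alt_rel.intros(5), of k] unfolding rel .
    qed
  next
    case (13 k) show ?case
    proof (cases k)
      case 0 show ?thesis unfolding 0 bs by (simp add: z left_diff_distrib)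
    next
      case (Suc k) show ?thesis unfolding Suc bs using R[OF alt_rel.intros(6), of k] unfolding rel .
    qed
  next
    case (14 k l) show ?case unfolding bs using R[OF alt_rel.intros(7), of k l] unfolding rel .
  next
    case (15 k l) show ?case
    proof (cases "k = 0 \<or> l = 0")
      case True then show ?thesis by (auto simp: z word_Nil)
    next
      case False then obtain k' l' where "k = Suc k'" "l = Suc l'" by (metis not0_implies_Suc)
      then show ?thesis using R[OF alt_rel.intros(14), of k' l'] unfolding rel by (simp only: bs)
    qed
  next
    case (16 k l) show ?case
    proof (cases "k = 0 \<or> l = 0")
      case True then show ?thesis by (auto simp: z word_Nil)
    next
      case False then obtain k' l' where "k = Suc k'" "l = Suc l'" by (metis not0_implies_Suc)
      then show ?thesis using R[OF alt_rel.intros(15), of k' l'] unfolding rel by (simp only: bs)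
    qed
  next
    case (17 k l) show ?case unfolding bs using R[OF alt_rel.intros(8), of k l] unfolding rel .
  next
    case (18 k l) show ?case unfolding bs using R[OF alt_rel.intros(10), of k l] unfolding rel by (simp add: algebra_simps)
  next
    case (19 k l) show ?case unfolding bs using R[OF alt_rel.intros(11), of k l] unfolding rel by (simp add: algebra_simps)
  next
    case (20 k l) show ?case unfolding bs using R[OF alt_rel.intros(12), of k l] unfolding rel by (simp add: algebra_simps)
  next
    case (21 k l) show ?case unfolding bs using R[OF alt_rel.intros(13), of k l] unfolding rel by (simp add: algebra_simps)
  next
    case (22 k l) show ?case unfolding bs using R[OF alt_rel.intros(9), of k l] unfolding rel by (simp add: algebra_simps)
  next
    case (23 k l) show ?case
    proof (cases "k = 0 \<or> l = 0")
      case True then show ?thesis by (auto simp: z word_Nil)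
    next
      case False then obtain k' l' where kl: "k = Suc k'" "l = Suc l'" by (metis not0_implies_Suc)
      show ?thesis unfolding kl bs using R[OF alt_rel.intros(16), of k' l'] unfolding rel by (simp add: algebra_simps)
    qed
  qed
qed

section \<open>Straightening of pairs of generators\<close>

fun kind :: "alt_gen \<Rightarrow> nat" where
  "kind (Wneg k) = 0" | "kind (G k) = 1" | "kind (Gt k) = 2" | "kind (Wpos k) = 3"

context
  fixes q :: "'f::field"
  assumes q: "q \<noteq> 0" "q\<^sup>2 \<noteq> 1"
begin

interpretation R: alternating_relations "relation_ideal (alt_rel q)" "scalar q" "scalar (inverse q)"
  "scalar (inverse (q - inverse q))" "\<lambda>k. word [Wneg k]" "\<lambda>k. word (bword k)" "\<lambda>k. word (cword k)" "\<lambda>k. word [Wpos k]"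
  by (rule alternating_relations_free[OF q])

interpretation R': alternating_relations "relation_ideal (alt_rel q)" "scalar q" "scalar (inverse q)"
  "scalar (inverse (q - inverse q))" "\<lambda>k. word [Wpos k]" "\<lambda>k. word (cword k)" "\<lambda>k. word (bword k)" "\<lambda>k. word [Wneg k]"
  by (rule R.swap)

interpretation J: two_sided_ideal "relation_ideal (alt_rel q)"
  by unfold_locales (rule relation_ideal_closed; assumption?)+

abbreviation "J \<equiv> relation_ideal (alt_rel q)"

lemma span_scalar_factor:
  assumes "x \<in> word_span J W"
  shows "(1 - scalar e * scalar e) * x \<in> word_span J W" "(scalar e * scalar e - 1) * x \<in> word_span J W"
  using assms by (simp_all only: left_diff_distrib mult_1_left mult.assoc J.span_diff J.span_scalar)

text \<open>With a fixed sum of degrees, the sum of squares grows with their difference. Against the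
  index pair \<open>(k, Suc j)\<close>, \<open>rel2\<close> offers \<open>(j, Suc k)\<close>, which
  is farther apart if \<open>j < k\<close>, and \<open>rel3\<close> offers
  \<open>(Suc j, k)\<close>, which is farther apart otherwise.\<close>

lemma odd_even_straightening:
  fixes u v :: "nat \<Rightarrow> alt_gen list" and e f :: 'f
  assumes deg: "\<And>k. total_degree (u k) = 2 * k + 1" "\<And>k. degree_squares (u k) = (2 * k + 1)\<^sup>2"
      "\<And>k. total_degree (v k) = 2 * k" "\<And>k. degree_squares (v k) = (2 * k)\<^sup>2"
    and ef: "e * f = 1"
    and rel2: "\<And>k l. word (u k) * word (v (Suc l)) - word (v (Suc l)) * word (u k)
      - (word (u l) * word (v (Suc k)) - word (v (Suc k)) * word (u l)) \<in> J"
    and rel3: "\<And>k l. scalar e * word (u k) * word (v l) - scalar f * word (v l) * word (u k)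
      - (scalar e * word (u l) * word (v k) - scalar f * word (v k) * word (u l)) \<in> J"
  shows "word (v (Suc j) @ u k) \<in> word_span J (insert (u k @ v (Suc j)) (higher (v (Suc j) @ u k)))" (is ?vu)
    and "word (u k @ v (Suc j)) \<in> word_span J (insert (v (Suc j) @ u k) (higher (u k @ v (Suc j))))" (is ?uv)
proof -
  have ef': "scalar e * (scalar f * x) = x" "scalar f * (scalar e * x) = x" for x :: "(alt_gen, 'f) free_algebra"
    using ef by (simp_all add: scalar_simps(3) mult.commute flip: mult.assoc scalar_simps(2))
  have "?vu \<and> ?uv"
  proof (cases "j < k")
    case True
    then have high: "u j @ v (Suc k) \<in> higher (v (Suc j) @ u k)" "v (Suc k) @ u j \<in> higher (v (Suc j) @ u k)"
      "u j @ v (Suc k) \<in> higher (u k @ v (Suc j))" "v (Suc k) @ u j \<in> higher (u k @ v (Suc j))"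
      by (simp_all add: higher_def total_words squares_words deg power2_eq_square algebra_simps)
    have "word (v (Suc j) @ u k) - (word (u k @ v (Suc j)) - word (u j @ v (Suc k)) + word (v (Suc k) @ u j)) \<in> J"
      using R.I_uminus[OF rel2[of k j]] by (simp add: word_mult algebra_simps)
    then have ?vu
      by (rule J.span_cong) (intro J.span_add J.span_diff J.span_word; simp add: high)
    have "word (u k @ v (Suc j)) - (word (v (Suc j) @ u k) + word (u j @ v (Suc k)) - word (v (Suc k) @ u j)) \<in> J"
      using rel2[of k j] by (simp add: word_mult algebra_simps)
    then have ?uv
      by (rule J.span_cong) (intro J.span_add J.span_diff J.span_word; simp add: high)
    with \<open>?vu\<close> show ?thesis by blast
  next
    case False
    then have high: "u (Suc j) @ v k \<in> higher (v (Suc j) @ u k)" "v k @ u (Suc j) \<in> higher (v (Suc j) @ u k)"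
      "u (Suc j) @ v k \<in> higher (u k @ v (Suc j))" "v k @ u (Suc j) \<in> higher (u k @ v (Suc j))"
      by (simp_all add: higher_def total_words squares_words deg power2_eq_square algebra_simps)
    \<comment> \<open>Scaling by \<open>e\<close> gives the wanted word coefficient 1, since
      \<open>e * f = 1\<close>; for the opposite order below, scaling by \<open>f\<close> does the
      same.\<close>
    have "word (v (Suc j) @ u k) - (scalar e * (scalar e * word (u k @ v (Suc j)))
        - scalar e * (scalar e * word (u (Suc j) @ v k)) + word (v k @ u (Suc j))) \<in> J"
      using R.I_uminus[OF J.left[OF rel3[of k "Suc j"], of "scalar e"]]
      by (simp add: word_mult algebra_simps ef')
    then have ?vu
      by (rule J.span_cong) (intro J.span_add J.span_diff J.span_scalar J.span_word; simp add: high)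
    have "word (u k @ v (Suc j)) - (scalar f * (scalar f * word (v (Suc j) @ u k))
        + word (u (Suc j) @ v k) - scalar f * (scalar f * word (v k @ u (Suc j)))) \<in> J"
      using J.left[OF rel3[of k "Suc j"], of "scalar f"]
      by (simp add: word_mult algebra_simps ef')
    then have ?uv
      by (rule J.span_cong) (intro J.span_add J.span_diff J.span_scalar J.span_word; simp add: high)
    with \<open>?vu\<close> show ?thesis by blast
  qed
  then show ?vu ?uv by blast+
qed

text \<open>For \<open>l = 0\<close> relation \<open>AD2\<close> yields single letters of the full
  degree. Otherwise \<open>AD6\<close> trades the indices \<open>(k, l)\<close> for
  \<open>(Suc k, l - 1)\<close> and for products of even letters, all with degrees farther apart
  because \<open>l \<le> k\<close>.\<close>

lemma AD_commutator:
  assumes "l \<le> k" and W: "W = {v. total_degree v = 2 * k + 2 * l + 2 \<and> (2 * k + 1)\<^sup>2 + (2 * l + 1)\<^sup>2 < degree_squares v}"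
  shows "word [Wneg k] * word [Wpos l] - word [Wpos l] * word [Wneg k] \<in> word_span J W"
proof (cases l)
  case 0
  have "word (cword (Suc k)) - word (bword (Suc k)) \<in> word_span J W"
    by (intro J.span_diff J.span_word) (simp_all add: W 0 total_words squares_words power2_eq_square)
  with J.span_cong[OF R.AD2[of k] span_scalar_factor(1)] show ?thesis by (simp only: 0)
next
  case (Suc j)
  have "word [Wneg (Suc k)] * word [Wpos j] - word [Wpos j] * word [Wneg (Suc k)]
      + (1 - scalar (inverse q) * scalar (inverse q)) * (word (bword (Suc j)) * word (cword (Suc k))
        - word (bword (Suc k)) * word (cword (Suc j))) \<in> word_span J W"
    unfolding word_mult
    using assms(1)
    by (intro J.span_add J.span_diff J.span_word span_scalar_factor)
      (simp_all add: W Suc total_words squares_words power2_eq_square algebra_simps)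
  from J.span_cong[OF R.AD6[of k j, unfolded diff_diff_eq[of "word [Wneg k] * word [Wpos (Suc j)] - word [Wpos (Suc j)] * word [Wneg k]"]] this]
  show ?thesis by (simp only: Suc)
qed

text \<open>\<open>CB7\<close> lowers the index of \<open>Gt\<close> and raises that of
  \<open>G\<close>, which separates the degrees when \<open>k \<le> j\<close>; so do its products of
  odd letters.\<close>

lemma CB_commutator:
  assumes "k \<le> j" and W: "W = {v. total_degree v = 2 * k + 2 * j + 4 \<and> (2 * k + 2)\<^sup>2 + (2 * j + 2)\<^sup>2 < degree_squares v}"
  shows "word [Gt k] * word [G j] - word [G j] * word [Gt k] \<in> word_span J W"
proof -
  have "word (cword k) * word (bword (Suc (Suc j))) - word (bword (Suc (Suc j))) * word (cword k)
      + (scalar q * scalar q - 1) * (word [Wneg (Suc j)] * word [Wpos k] - word [Wneg k] * word [Wpos (Suc j)]) \<in> word_span J W"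
    unfolding word_mult
    using assms(1)
    by (intro J.span_add J.span_diff J.span_word span_scalar_factor)
      (simp_all add: W total_words squares_words power2_eq_square algebra_simps)
  from J.span_cong[OF _ this] R.I_uminus[OF R.CB7[of k "Suc j"]] show ?thesis
    by (simp add: algebra_simps)
qed

text \<open>Letters of one kind commute modulo the ideal. Pairs of different parity fall under
  \<open>odd_even_straightening\<close>; for \<open>Wneg\<close> with \<open>Wpos\<close> and
  \<open>G\<close> with \<open>Gt\<close> the commutator consists of higher words.\<close>

theorem pair_straightening:
  assumes "kind g \<le> kind h"
  shows "word [h, g] \<in> word_span J (insert [g, h] (higher [h, g]))"
proof -
  have comm: ?thesis if "word [h] * word [g] - word [g] * word [h] \<in> word_span J (higher [h, g])"
  proof -
    have "word [h] * word [g] - word [g] * word [h] + word [g, h] \<in> word_span J (insert [g, h] (higher [h, g]))"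
      by (rule J.span_add[OF J.span_trans[OF that] J.span_word]) (simp_all add: J.span_word)
    then show ?thesis by (simp add: word_mult)
  qed
  have comm0: ?thesis if "word [h] * word [g] - word [g] * word [h] \<in> J"
    using that comm J.span_cong[of _ 0] J.span_0 by simp
  show ?thesis
  proof (cases g)
    case g: (Wneg k)
    show ?thesis
    proof (cases h)
      case h: (Wneg l)
      show ?thesis unfolding g h by (rule comm0[unfolded g h]) (rule R.AA)
    next
      case h: (G j)
      show ?thesis
        using odd_even_straightening(1)[of "\<lambda>k. [Wneg k]" bword q "inverse q", OF _ _ _ _ _ R.AB2 R.AB3, of j k] q
        by (simp add: g h total_words squares_words)
    next
      case h: (Gt j)
      \<comment> \<open>The relation \<open>AC3\<close> regrouped so that the odd letter comes
        first, which exchanges the roles of \<open>q\<close> and its inverse.\<close>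
      have "scalar (inverse q) * word [Wneg k] * word (cword l) - scalar q * word (cword l) * word [Wneg k]
        - (scalar (inverse q) * word [Wneg l] * word (cword k) - scalar q * word (cword k) * word [Wneg l]) \<in> J" for k l
        using R.AC3[of k l] by (simp add: R.ac3_def algebra_simps)
      note odd_even_straightening(1)[of "\<lambda>k. [Wneg k]" cword "inverse q" q, OF _ _ _ _ _ R.AC2 this, of j k]
      then show ?thesis
        using q by (simp add: g h total_words squares_words)
    next
      case h: (Wpos l)
      \<comment> \<open>\<open>AD_commutator\<close> needs the larger index on \<open>Wneg\<close>;
        in the other case \<open>AD4\<close> exchanges the indices.\<close>
      have *: "word [Wneg k] * word [Wpos l] - word [Wpos l] * word [Wneg k] \<in> word_span J (higher [h, g])"
      proof (cases "l \<le> k")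
        case True
        then show ?thesis
          by (rule AD_commutator) (auto simp: g h higher_def total_words squares_words)
      next
        case False
        then have "word [Wneg l] * word [Wpos k] - word [Wpos k] * word [Wneg l] \<in> word_span J (higher [h, g])"
          by (intro AD_commutator) (auto simp: g h higher_def total_words squares_words add_ac)
        then show ?thesis by (rule J.span_cong[OF R.AD4])
      qed
      show ?thesis
        by (rule comm) (use J.span_diff[OF J.span_0 *] in \<open>simp add: g h\<close>)
    qed
  next
    case g: (G j)
    show ?thesis
    proof (cases h)
      case (Wneg l) then show ?thesis using assms g by simp
    next
      case h: (G l)
      show ?thesis unfolding g h by (rule comm0[unfolded g h]) (use R.BB[of "Suc l" "Suc j"] in simp)
    next
      case h: (Gt k)
      show ?thesis
      proof (rule comm, cases "k \<le> j")
        case True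
        then show "word [h] * word [g] - word [g] * word [h] \<in> word_span J (higher [h, g])"
          unfolding g h by (rule CB_commutator) (auto simp: higher_def total_words squares_words)
      next
        case False
        then have "word [Gt j] * word [G k] - word [G k] * word [Gt j] \<in> word_span J (higher [h, g])"
          unfolding g h by (intro CB_commutator) (auto simp: higher_def total_words squares_words add_ac)
        then show "word [h] * word [g] - word [g] * word [h] \<in> word_span J (higher [h, g])"
          using J.span_cong[OF R.CB5[of "Suc k" "Suc j"]] by (simp add: g h)
      qed
    next
      case h: (Wpos k)
      have "scalar (inverse q) * word [Wpos k] * word (bword l) - scalar q * word (bword l) * word [Wpos k]
        - (scalar (inverse q) * word [Wpos l] * word (bword k) - scalar q * word (bword k) * word [Wpos l]) \<in> J" for k l
        using R'.AC3[of k l] by (simp add: R'.ac3_def algebra_simps)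
      note odd_even_straightening(2)[of "\<lambda>k. [Wpos k]" bword "inverse q" q, OF _ _ _ _ _ R'.AC2 this, of k j]
      then show ?thesis
        using q by (simp add: g h total_words squares_words)
    qed
  next
    case g: (Gt j)
    show ?thesis
    proof (cases h)
      case (Wneg l) then show ?thesis using assms g by simp
    next
      case (G l) then show ?thesis using assms g by simp
    next
      case h: (Gt l)
      show ?thesis unfolding g h by (rule comm0[unfolded g h]) (use R.CC[of "Suc l" "Suc j"] in simp)
    next
      case h: (Wpos k)
      show ?thesis
        using odd_even_straightening(2)[of "\<lambda>k. [Wpos k]" cword q "inverse q", OF _ _ _ _ _ R'.AB2 R'.AB3, of k j] q
        by (simp add: g h total_words squares_words)
    qed
  next
    case g: (Wpos k)
    show ?thesis
    proof (cases h)
      case h: (Wpos l)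
      show ?thesis unfolding g h by (rule comm0[unfolded g h]) (rule R.DD)
    qed (use assms g in simp_all)
  qed
qed

end

text \<open>Within one kind \<open>r\<close> is arbitrary, so a pair out of order satisfies only
  \<open>kind g \<le> kind h\<close>.\<close>

theorem ordered_words_span:
  fixes q :: "'f::field" and r :: "alt_gen rel"
  assumes q: "q \<noteq> 0" "q\<^sup>2 \<noteq> 1" and r: "linear_order_on UNIV r"
    and kind: "\<And>g h. kind g < kind h \<Longrightarrow> (g, h) \<in> r"
  shows "x \<in> word_span (relation_ideal (alt_rel q)) {w. sorted_wrt (\<lambda>a b. (a, b) \<in> r) w}"
proof -
  interpret two_sided_ideal "relation_ideal (alt_rel q)"
    by unfold_locales (rule relation_ideal_closed; assumption?)+
  have "word w \<in> word_span (relation_ideal (alt_rel q)) {w. sorted_wrt (\<lambda>a b. (a, b) \<in> r) w}" for w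
  proof (rule straightening[OF two_sided_ideal_axioms r])
    fix h g assume "(h, g) \<notin> r"
    then have "kind g \<le> kind h" using kind[of h g] by (cases "kind h < kind g") auto
    then show "word [h, g] \<in> word_span (relation_ideal (alt_rel q)) (insert [g, h] (higher [h, g]))"
      by (rule pair_straightening[OF q])
  qed
  then show ?thesis by (rule free_in_span)
qed

section \<open>The PBW basis\<close>

definition proj :: "(('g, 'f::field) free_algebra \<Rightarrow> ('g, 'f) free_algebra \<Rightarrow> bool) \<Rightarrow> ('g, 'f) free_algebra \<Rightarrow> ('g, 'f) free_algebra set" where
  "proj E x = relation_ideal E +>\<^bsub>class_ring\<^esub> x"

lemma
  fixes E :: "('g, 'f::field) free_algebra \<Rightarrow> ('g, 'f) free_algebra \<Rightarrow> bool"
  shows proj_mult: "proj E x \<otimes>\<^bsub>presented_algebra E\<^esub> proj E y = proj E (x * y)"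
    and proj_add: "proj E x \<oplus>\<^bsub>presented_algebra E\<^esub> proj E y = proj E (x + y)"
    and proj_one: "\<one>\<^bsub>presented_algebra E\<^esub> = proj E 1"
    and proj_zero: "\<zero>\<^bsub>presented_algebra E\<^esub> = proj E 0"
    and proj_smult: "c \<odot>\<^bsub>presented_algebra E\<^esub> proj E x = proj E (scalar c * x)"
    and proj_carrier: "carrier (presented_algebra E) = range (proj E)"
    and proj_eq_iff: "proj E x = proj E y \<longleftrightarrow> x - y \<in> relation_ideal E"
proof -
  define R :: "('g, 'f) free_algebra ring" where "R = class_ring"
  have R: "ring R" unfolding R_def by (rule class_ring.ring_axioms)
  interpret I: ideal "relation_ideal E" R
    using ring.genideal_ideal[OF R, of "{x - y | x y. E x y}"] by (simp add: R_def relation_ideal_def)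
  interpret h: ring_hom_ring R "R Quot relation_ideal E" "(+>\<^bsub>R\<^esub>) (relation_ideal E)"
    by (rule I.rcos_ring_hom_ring)
  have P: "proj E x = relation_ideal E +>\<^bsub>R\<^esub> x" for x by (simp add: proj_def R_def)
  let ?Q = "R Quot relation_ideal E"
  have A: "x \<otimes>\<^bsub>presented_algebra E\<^esub> y = x \<otimes>\<^bsub>?Q\<^esub> y" "x \<oplus>\<^bsub>presented_algebra E\<^esub> y = x \<oplus>\<^bsub>?Q\<^esub> y"
    "\<one>\<^bsub>presented_algebra E\<^esub> = \<one>\<^bsub>?Q\<^esub>" "\<zero>\<^bsub>presented_algebra E\<^esub> = \<zero>\<^bsub>?Q\<^esub>"
    "c \<odot>\<^bsub>presented_algebra E\<^esub> x = (relation_ideal E +>\<^bsub>R\<^esub> scalar c) \<otimes>\<^bsub>?Q\<^esub> x"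
    "carrier (presented_algebra E) = carrier ?Q" for x y c
    by (simp_all add: presented_algebra_def Let_def R_def)
  have U: "x \<in> carrier R" "x \<otimes>\<^bsub>R\<^esub> y = x * y" "x \<oplus>\<^bsub>R\<^esub> y = x + y" "\<one>\<^bsub>R\<^esub> = 1" "\<zero>\<^bsub>R\<^esub> = 0" for x y
    by (simp_all add: R_def)
  show "proj E x \<otimes>\<^bsub>presented_algebra E\<^esub> proj E y = proj E (x * y)"
    using h.hom_mult[OF U(1) U(1), of x y] by (simp add: P A U)
  show "proj E x \<oplus>\<^bsub>presented_algebra E\<^esub> proj E y = proj E (x + y)"
    using h.hom_add[OF U(1) U(1), of x y] by (simp add: P A U)
  show "\<one>\<^bsub>presented_algebra E\<^esub> = proj E 1"
    using h.hom_one by (simp add: P A U)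
  show "\<zero>\<^bsub>presented_algebra E\<^esub> = proj E 0"
    using h.hom_zero by (simp add: P A U)
  show "c \<odot>\<^bsub>presented_algebra E\<^esub> proj E x = proj E (scalar c * x)"
    using h.hom_mult[OF U(1) U(1), of "scalar c" x] by (simp add: P A U)
  show "carrier (presented_algebra E) = range (proj E)"
    unfolding A FactRing_def A_RCOSETS_def' using U(1) by (auto simp: P)
  have "x \<ominus>\<^bsub>R\<^esub> y = x - y" by (simp add: R_def class_ring_simps)
  then show "proj E x = proj E y \<longleftrightarrow> x - y \<in> relation_ideal E"
    using ring.quotient_eq_iff_same_a_r_cos[OF R I.ideal_axioms U(1) U(1), of x y] by (simp add: P)
qed

lemma proj_word: "list_prod (presented_algebra E) (map (presented_gen E) w) = proj E (word w)"
proof (induction w)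
  case Nil
  show ?case by (simp add: list_prod_def proj_one word_Nil)
next
  case (Cons g w)
  have "presented_gen E g = proj E (word [g])"
    by (simp add: presented_gen_def proj_def letter_def)
  with Cons show ?case
    by (simp add: list_prod_def proj_mult word_mult)
qed

text \<open>Both first letters are least in the same multiset, hence equal by antisymmetry.\<close>

lemma sorted_wrt_mset_unique:
  assumes "antisym r" "sorted_wrt (\<lambda>a b. (a, b) \<in> r) v" "sorted_wrt (\<lambda>a b. (a, b) \<in> r) w" "mset v = mset w"
  shows "v = w"
  using assms(2-4)
proof (induction v arbitrary: w)
  case Nil
  then show ?case by simp
next
  case (Cons x v)
  then obtain y w' where w: "w = y # w'" by (cases w) auto
  have "set (x # v) = set w" by (rule mset_eq_setD[OF Cons.prems(3)])
  then have "x = y \<or> (y, x) \<in> r" "x = y \<or> (x, y) \<in> r"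
    using Cons.prems(1,2) unfolding w by auto
  then have xy: "x = y" using assms(1) by (auto dest: antisymD)
  moreover have "v = w'"
    by (rule Cons.IH) (use Cons.prems xy in \<open>simp_all add: w\<close>)
  ultimately show ?case by (simp add: w)
qed

lemma proj_sum_lincomb:
  fixes E :: "('g, 'f::field) free_algebra \<Rightarrow> ('g, 'f) free_algebra \<Rightarrow> bool"
  assumes "finite A" "\<And>v. v \<in> A \<Longrightarrow> proj E (word (f v)) = v"
  shows "module.lincomb (presented_algebra E) a A = proj E (\<Sum>v\<in>A. scalar (a v) * word (f v))"
proof -
  interpret V: vectorspace class_ring "presented_algebra E" by (rule vectorspace_presented_algebra)
  from assms show ?thesis
  proof (induction A rule: finite_induct)
    case empty
    show ?case by (simp add: V.lincomb_def proj_zero)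
  next
    case (insert v A)
    have v: "v = proj E (word (f v))" using insert.prems by simp
    have "a u \<odot>\<^bsub>presented_algebra E\<^esub> u \<in> carrier (presented_algebra E)" if "u \<in> insert v A" for u
      using insert.prems[OF that] proj_smult[of E "a u" "word (f u)"] by (simp add: proj_carrier)
    then have "V.lincomb a (insert v A) = a v \<odot>\<^bsub>presented_algebra E\<^esub> v \<oplus>\<^bsub>presented_algebra E\<^esub> V.lincomb a A"
      unfolding V.lincomb_def using insert.hyps by (intro V.M.finsum_insert) auto
    also have "a v \<odot>\<^bsub>presented_algebra E\<^esub> v = proj E (scalar (a v) * word (f v))"
      by (subst v) (rule proj_smult)
    finally show ?case using insert by (simp add: proj_add)
  qed
qed

text \<open>Both hypotheses live in the free algebra; a linear dependence of classes is lifted there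
  by choosing one word per class.\<close>

theorem proj_words_basis:
  fixes E :: "('g, 'f::field) free_algebra \<Rightarrow> ('g, 'f) free_algebra \<Rightarrow> bool"
  assumes span: "\<And>x. x \<in> word_span (relation_ideal E) W"
    and indep: "\<And>x. x \<in> relation_ideal E \<Longrightarrow> Poly_Mapping.keys x \<subseteq> W \<Longrightarrow> x = 0"
  shows "vectorspace.basis class_ring (presented_algebra E) ((\<lambda>w. proj E (word w)) ` W)"
proof -
  interpret V: vectorspace class_ring "presented_algebra E" by (rule vectorspace_presented_algebra)
  let ?B = "(\<lambda>w. proj E (word w)) ` W"
  have B: "?B \<subseteq> carrier (presented_algebra E)" by (auto simp: proj_carrier)
  interpret S: submodule class_ring "V.span ?B" "presented_algebra E"
    by (rule V.span_is_submodule[OF B])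
  have "proj E y \<in> V.span ?B" if "Poly_Mapping.keys y \<subseteq> W" for y
    using that
  proof (induction y rule: update_induct)
    case const
    show ?case using S.zero_closed by (simp add: proj_zero)
  next
    case (update f v e)
    have eq: "Poly_Mapping.update v e f = f + scalar e * word v"
      using update(1) by (intro poly_mapping_eqI)
        (auto simp: scalar_def mult_single plus_list_def lookup_update lookup_add lookup_single when_def in_keys_iff update.rep_eq)
    have keys: "Poly_Mapping.keys (Poly_Mapping.update v e f) = insert v (Poly_Mapping.keys f)"
      using update(1,2) by (auto simp: in_keys_iff lookup_update split: if_splits)
    have "proj E (word v) \<in> V.span ?B"
      using V.in_own_span[OF B] update.prems keys by blast
    with update keys show ?case
      unfolding eq proj_add[symmetric] proj_smult[symmetric] by (intro S.m_closed S.smult_closed) auto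
  qed
  note free = this
  have "proj E x \<in> V.span ?B" for x
  proof -
    obtain y where "Poly_Mapping.keys y \<subseteq> W" "x - y \<in> relation_ideal E"
      using span[of x] unfolding word_span_def by blast
    then have "proj E y \<in> V.span ?B" "proj E x = proj E y" using free by (simp_all add: proj_eq_iff)
    then show ?thesis by simp
  qed
  then have gen: "V.gen_set ?B"
    using V.span_is_subset2[OF B] by (auto simp: proj_carrier)
  have "V.lin_indpt ?B"
  proof
    assume "V.lin_dep ?B"
    then obtain A a v where A: "finite A" "A \<subseteq> ?B" "V.lincomb a A = \<zero>\<^bsub>presented_algebra E\<^esub>" "v \<in> A" "a v \<noteq> 0"
      unfolding V.lin_dep_def by auto
    then have "\<forall>u\<in>A. \<exists>w\<in>W. proj E (word w) = u" by blast
    then obtain f where f: "\<And>u. u \<in> A \<Longrightarrow> f u \<in> W" "\<And>u. u \<in> A \<Longrightarrow> proj E (word (f u)) = u" by metis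
    define y where "y = (\<Sum>u\<in>A. scalar (a u) * word (f u))"
    have y_single: "y = (\<Sum>u\<in>A. Poly_Mapping.single (f u) (a u))"
      by (simp only: y_def single_eq_word [symmetric])
    have "proj E y = proj E 0"
      using proj_sum_lincomb[OF A(1) f(2), of a] A(3) by (simp only: y_def proj_zero)
    then have "y \<in> relation_ideal E" by (simp add: proj_eq_iff)
    moreover have "Poly_Mapping.keys y \<subseteq> W"
      unfolding y_single using keys_sum[of "\<lambda>u. Poly_Mapping.single (f u) (a u)" A] f(1) by (fastforce split: if_splits)
    ultimately have "y = 0" by (rule indep)
    \<comment> \<open>The choice \<open>f\<close> is injective on \<open>A\<close>, as
      \<open>proj E (word (f u)) = u\<close>, so no two coefficients merge.\<close>
    have "Poly_Mapping.lookup y (f v) = (\<Sum>u\<in>A. if u = v then a u else 0)"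
      unfolding y_single lookup_sum lookup_single when_def
      by (rule sum.cong) (use f(2) A(4) in \<open>metis+\<close>)
    also have "\<dots> = a v" using A(1,4) by simp
    finally show False using A(5) \<open>y = 0\<close> by simp
  qed
  with gen B show ?thesis unfolding V.basis_def by blast
qed

theorem theorem10p2:
  fixes q :: "'f::field" and r :: "alt_gen rel"
  assumes "q \<noteq> 0"
    and "\<forall>n>0. q ^ n \<noteq> 1"
    and "linear_order_on UNIV r"
    and "\<forall>i j. (Wneg i, G j) \<in> r"
    and "\<forall>j k. (G j, Gt k) \<in> r"
    and "\<forall>k l. (Gt k, Wpos l) \<in> r"
  shows "inj (Uq_gen q) \<and>
    PBW_basis class_ring (Uq_plus q) (range (Uq_gen q)) (map_prod (Uq_gen q) (Uq_gen q) ` r)"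
proof -
  let ?E = "alt_rel q" and ?gen = "Uq_gen q"
  let ?W = "{w. sorted_wrt (\<lambda>a b. (a, b) \<in> r) w}"
  let ?r = "map_prod ?gen ?gen ` r"
  have q2: "q\<^sup>2 \<noteq> 1" using assms(2) by simp
  have r: "refl r" "trans r" "antisym r" "total_on UNIV r"
    using assms(3) by (auto simp: linear_order_on_def partial_order_on_def preorder_on_def)
  have kind: "(g, h) \<in> r" if "kind g < kind h" for g h
  proof -
    have "(Wneg i, Gt k) \<in> r" "(G i, Wpos k) \<in> r" for i k
      using assms(4-6) transD[OF r(2)] by blast+
    moreover from this have "(Wneg i, Wpos k) \<in> r" for i k
      using assms(4) transD[OF r(2)] by blast
    ultimately show ?thesis
      using that assms(4-6) by (cases g; cases h; simp)
  qed
  have span: "x \<in> word_span (relation_ideal ?E) ?W" for x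
    by (rule ordered_words_span[OF assms(1) q2 assms(3) kind])
  have inj_mset: "inj_on mset ?W"
    by (rule inj_onI) (use sorted_wrt_mset_unique[OF r(3)] in blast)
  have indep: "x = 0" if "x \<in> relation_ideal ?E" "Poly_Mapping.keys x \<subseteq> ?W" for x
    using ordered_words_independent[OF assms(1) that(1) inj_on_subset[OF inj_mset that(2)]] .
  have word_inj: "v = w" if "v \<in> ?W" "w \<in> ?W" "proj ?E (word v) = proj ?E (word w)" for v w
  proof (rule ccontr)
    assume "v \<noteq> w"
    \<comment> \<open>If two sorted words had the same class, their difference would be an element
      of the ideal supported on sorted words.\<close>
    have "Poly_Mapping.keys (word v - word w :: (alt_gen, 'f) free_algebra) \<subseteq> {v, w}"
      using keys_diff[of "word v" "word w"] by auto
    then have "word v - word w = (0 :: (alt_gen, 'f) free_algebra)"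
      using that by (intro indep) (auto simp: proj_eq_iff)
    then have "Poly_Mapping.lookup (word v) v = Poly_Mapping.lookup (word w :: (alt_gen, 'f) free_algebra) v" by simp
    with \<open>v \<noteq> w\<close> show False by (simp add: lookup_single)
  qed
  have gen: "list_prod (Uq_plus q) (map ?gen w) = proj ?E (word w)" for w
    unfolding Uq_plus_def Uq_gen_def by (rule proj_word)
  have gen1: "?gen g = proj ?E (word [g])" for g
    by (simp add: Uq_gen_def presented_gen_def proj_def letter_def)
  have inj: "inj ?gen"
    by (rule injI) (use word_inj[of "[_]" "[_]"] in \<open>simp add: gen1\<close>)
  have mem: "(?gen g, ?gen h) \<in> ?r \<longleftrightarrow> (g, h) \<in> r" for g h
    using inj by (auto simp: inj_eq)
  \<comment> \<open>Sequences of generators are images of words, and \<open>mem\<close> translates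
    their order, so nondecreasing sequences correspond to sorted words.\<close>
  have S: "{as. set as \<subseteq> range ?gen \<and> sorted_wrt (\<lambda>a b. (a, b) \<in> ?r) as} = map ?gen ` ?W"
  proof (intro equalityI subsetI)
    fix as assume as: "as \<in> {as. set as \<subseteq> range ?gen \<and> sorted_wrt (\<lambda>a b. (a, b) \<in> ?r) as}"
    then have "as \<in> lists (range ?gen)" by (simp add: in_lists_conv_set subset_iff)
    then obtain w where w: "as = map ?gen w" by (auto simp: lists_image lists_UNIV)
    then show "as \<in> map ?gen ` ?W" using as by (auto simp: sorted_wrt_map mem)
  qed (auto simp: sorted_wrt_map mem)
  have lin: "linear_order_on (range ?gen) ?r"
    unfolding linear_order_on_def partial_order_on_def preorder_on_def
  proof (intro conjI)
    show "refl_on (range ?gen) ?r" using r(1) by (auto simp: refl_on_def)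
    show "trans ?r" using r(2) inj by (intro transI) (auto simp: inj_eq dest: transD)
    show "antisym ?r" using r(3) inj by (intro antisymI) (auto simp: inj_eq dest: antisymD)
    show "total_on (range ?gen) ?r" using r(4) inj by (auto simp: total_on_def inj_eq)
  qed auto
  have "PBW_basis class_ring (Uq_plus q) (range ?gen) ?r"
    unfolding PBW_basis_def S Let_def
  proof (intro conjI lin)
    show "range ?gen \<subseteq> carrier (Uq_plus q)" by (auto simp: Uq_plus_def proj_carrier gen1)
    show "inj_on (list_prod (Uq_plus q)) (map ?gen ` ?W)"
      by (rule inj_onI) (auto simp: gen dest: word_inj[OF CollectI CollectI, rotated 2])
    show "vectorspace.basis class_ring (Uq_plus q) (list_prod (Uq_plus q) ` map ?gen ` ?W)"
      using proj_words_basis[OF span indep] by (simp add: image_image gen) (simp add: Uq_plus_def)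
  qed
  with inj show ?thesis by blast
qed

end
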